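(* Let $G$ be a connected graph on $n$ vertices with second largest eigenvalue $\lambda_2 = \lambda_2(G) > 0$, and let $\Delta$ satisfy $\Delta \ge \Delta(G) \ge 2$. Then: (i) if $\lambda_2 \log \lambda_2 \ge \log_\Delta n > 2$, then $\displaystyle m_G(\lambda_2) \le \frac{4n \log^2 \log_\Delta n}{\log_\Delta n}$; (ii) if $\lambda_2 \log \lambda_2 \le \log_\Delta n$, then $\displaystyle m_G(\lambda_2) \le \frac{4n \log(\lambda_2+1)}{\lambda_2}$.
   Context: All graphs are finite and simple; eigenvalues are those of the adjacency matrix, $\Delta(G)$ is the maximum degree, and $m_G(\lambda)$ denotes the multiplicity of $\lambda$ as an eigenvalue of $G$. $\log$ is base $2$ and $\log_\Delta n = \log n/\log\Delta$. *)

theory Defs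
  imports
    "Graph_Theory.Digraph_Component"
    "Jordan_Normal_Form.Char_Poly"
begin

text \<open>
  A finite simple graph is an instance of the locale \<^locale>\<open>graph\<close>: a finite loop-free
  digraph without parallel arcs whose adjacency relation is symmetric, every edge being
  represented by its two orientations.  Hence out-degrees are the usual vertex degrees.
\<close>

definition max_degree :: "('a, 'b) pre_digraph \<Rightarrow> nat" where
  "max_degree G = Max (out_degree G ` verts G)"

text \<open>
  The adjacency matrix depends on an enumeration of the vertices.  One is fixed by choice;
  another one conjugates the matrix by a permutation matrix, which does not affect the
  characteristic polynomial.
\<close>

definition vertex_list :: "('a, 'b) pre_digraph \<Rightarrow> 'a list" where
  "vertex_list G = (SOME vs. distinct vs \<and> set vs = verts G)"

definition adjacency_matrix :: "('a, 'b) pre_digraph \<Rightarrow> real mat" where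
  "adjacency_matrix G =
     mat (card (verts G)) (card (verts G))
       (\<lambda>(i, j). if vertex_list G ! i \<rightarrow>\<^bsub>G\<^esub> vertex_list G ! j then 1 else 0)"

text \<open>
  The eigenvalues with multiplicity: the roots of the characteristic polynomial.
  Since the matrix is real symmetric, there are exactly as many real ones as vertices, and
  algebraic and geometric multiplicities coincide.
\<close>

definition graph_spectrum :: "('a, 'b) pre_digraph \<Rightarrow> real multiset" where
  "graph_spectrum G = proots (char_poly (adjacency_matrix G))"

definition eigenvalue_multiplicity :: "('a, 'b) pre_digraph \<Rightarrow> real \<Rightarrow> nat" where
  "eigenvalue_multiplicity G x = count (graph_spectrum G) x"

text \<open>
  The second entry of the list of eigenvalues in non-increasing order, repeated according to
  multiplicity.  It is meaningful for graphs with at least two vertices only.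
\<close>

definition second_eigenvalue :: "('a, 'b) pre_digraph \<Rightarrow> real" where
  "second_eigenvalue G = rev (sorted_list_of_multiset (graph_spectrum G)) ! 1"

end

theory Submission
  imports
    Defs
    "Jordan_Normal_Form.Schur_Decomposition"
    "HOL-Analysis.Convex"
begin

text \<open>
  Delete from the graph every vertex whose ball of radius \<open>r\<close> has spectral radius above
  \<open>\<lambda>\<^sub>2\<close>; all these vertices are close to each other, so they are at most \<open>\<Delta>\<close> to the power
  \<open>2r + 2\<close> many.  The remaining vertices have degree at most \<open>\<lambda>\<^sub>2\<close> squared and carry at most
  \<open>\<lambda>\<^sub>2\<close> to the power \<open>2r\<close> closed walks of length \<open>2r\<close> each.  Then delete a random set of
  density \<open>p\<close>: a closed walk visiting many vertices rarely survives, and there are few closed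
  walks visiting few vertices.  The trace of the \<open>2r\<close>-th power of the adjacency matrix of
  what is left therefore shows that \<open>\<lambda>\<^sub>2\<close> has small multiplicity there, while deleting a
  vertex lowers a multiplicity by at most one.  With \<open>M = \<lambda>\<^sub>2\<close> in (ii), \<open>M = L / log L\<close> and
  \<open>L = log\<^sub>\<Delta> n\<close> in (i), the choice \<open>p = 3 log M / M\<close> gives the bound \<open>4 n log M / M\<close>.
\<close>

subsection \<open>Symmetric matrices acting on functions\<close>

text \<open>Without the random set the trace argument is vacuous: each remaining vertex may carry
  \<open>l ^ (2 * r)\<close> closed walks, where \<open>l\<close> is the second eigenvalue, and
  dividing by that number returns no more than the trivial bound. Deleting a fraction p of the
  vertices leaves a walk with more than t vertices alive with probability at most (1 - p)^t, but
  hardly touches walks of small support, so these must be rare beforehand. Each vertex has at most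
  (t + 1)^(2 r) l^(2 t) of them, negligible against l^(2 r) once t + 1 \<le> l / 2 and r clearly
  exceeds t log l. This suggests t of order M, p of order log M / M and r at least of order M log M.
  On the other side, up to \<Delta>^(2 r + 2) vertices are exceptional, which must stay below n / M
  and caps 2 r near L. The two demands on r meet in the condition M log M \<le> L. In (i) the
  eigenvalue itself may violate it, and a smaller M stands in; the estimates only ask for M \<le>
  l.\<close>

definition inner_on :: "'a set \<Rightarrow> ('a \<Rightarrow> real) \<Rightarrow> ('a \<Rightarrow> real) \<Rightarrow> real" where
  "inner_on V f g = (\<Sum>v\<in>V. f v * g v)"

definition orthonormal_on :: "'a set \<Rightarrow> 'i set \<Rightarrow> ('i \<Rightarrow> 'a \<Rightarrow> real) \<Rightarrow> bool" where
  "orthonormal_on V I x \<longleftrightarrow> (\<forall>i\<in>I. \<forall>j\<in>I. inner_on V (x i) (x j) = (if i = j then 1 else 0))"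

definition mat_op :: "'a set \<Rightarrow> ('a \<Rightarrow> 'a \<Rightarrow> real) \<Rightarrow> ('a \<Rightarrow> real) \<Rightarrow> 'a \<Rightarrow> real" where
  "mat_op V a f v = (\<Sum>u\<in>V. a v u * f u)"

lemma inner_on_commute: "inner_on V f g = inner_on V g f"
  by (simp add: inner_on_def mult.commute)

lemma inner_on_nonneg: "0 \<le> inner_on V f f"
  by (simp add: inner_on_def sum_nonneg)

lemma inner_on_cong:
  "(\<And>v. v \<in> V \<Longrightarrow> f v = f' v) \<Longrightarrow> (\<And>v. v \<in> V \<Longrightarrow> g v = g' v) \<Longrightarrow> inner_on V f g = inner_on V f' g'"
  by (simp add: inner_on_def)

lemma inner_on_add_left: "inner_on V (\<lambda>v. f v + g v) h = inner_on V f h + inner_on V g h"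
  by (simp add: inner_on_def distrib_right sum.distrib)

lemma inner_on_diff_left: "inner_on V (\<lambda>v. f v - g v) h = inner_on V f h - inner_on V g h"
  by (simp add: inner_on_def left_diff_distrib sum_subtractf)

lemma inner_on_scale_left: "inner_on V (\<lambda>v. c * f v) h = c * inner_on V f h"
  by (simp add: inner_on_def sum_distrib_left mult.assoc)

lemma inner_on_sum_left: "inner_on V (\<lambda>v. \<Sum>i\<in>I. F i v) h = (\<Sum>i\<in>I. inner_on V (F i) h)"
  unfolding inner_on_def sum_distrib_right by (rule sum.swap)

lemma inner_on_add_right: "inner_on V h (\<lambda>v. f v + g v) = inner_on V h f + inner_on V h g"
  by (simp add: inner_on_def distrib_left sum.distrib)

lemma inner_on_diff_right: "inner_on V h (\<lambda>v. f v - g v) = inner_on V h f - inner_on V h g"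
  by (simp add: inner_on_def right_diff_distrib sum_subtractf)

lemma inner_on_scale_right: "inner_on V h (\<lambda>v. c * f v) = c * inner_on V h f"
  by (simp add: inner_on_def sum_distrib_left mult.left_commute)

lemma inner_on_sum_right: "inner_on V h (\<lambda>v. \<Sum>i\<in>I. F i v) = (\<Sum>i\<in>I. inner_on V h (F i))"
  unfolding inner_on_def sum_distrib_left by (rule sum.swap)

lemmas inner_on_linear = inner_on_add_left inner_on_diff_left inner_on_scale_left inner_on_sum_left
  inner_on_add_right inner_on_diff_right inner_on_scale_right inner_on_sum_right

lemma inner_on_pos:
  assumes "finite V" "v \<in> V" "f v \<noteq> 0"
  shows "0 < inner_on V f f"
  unfolding inner_on_def using assms by (intro sum_pos2[of V v]) (auto simp: zero_less_mult_iff)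

lemma mat_op_symmetric:
  assumes "\<And>u v. u \<in> V \<Longrightarrow> v \<in> V \<Longrightarrow> a u v = a v u"
  shows "inner_on V (mat_op V a f) g = inner_on V f (mat_op V a g)"
proof -
  have "inner_on V (mat_op V a f) g = (\<Sum>v\<in>V. \<Sum>u\<in>V. a v u * f u * g v)"
    by (simp add: inner_on_def mat_op_def sum_distrib_right)
  also have "\<dots> = (\<Sum>u\<in>V. \<Sum>v\<in>V. a v u * f u * g v)" by (rule sum.swap)
  also have "\<dots> = inner_on V f (mat_op V a g)"
    unfolding inner_on_def mat_op_def sum_distrib_left
    by (intro sum.cong refl) (simp add: assms mult.commute mult.left_commute)
  finally show ?thesis .
qed

lemma mat_op_sum: "mat_op V a (\<lambda>v. \<Sum>i\<in>I. F i v) v = (\<Sum>i\<in>I. mat_op V a (F i) v)"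
  unfolding mat_op_def sum_distrib_left by (rule sum.swap)

lemma mat_op_scale: "mat_op V a (\<lambda>v. c * f v) v = c * mat_op V a f v"
  by (simp add: mat_op_def sum_distrib_left mult.left_commute)

lemma mat_op_add: "mat_op V a (\<lambda>v. f v + g v) v = mat_op V a f v + mat_op V a g v"
  by (simp add: mat_op_def sum.distrib distrib_left)

lemma mat_op_diff: "mat_op V a (\<lambda>v. f v - g v) v = mat_op V a f v - mat_op V a g v"
  by (simp add: mat_op_def sum_subtractf right_diff_distrib)

lemma mat_op_cong: "(\<And>u. u \<in> V \<Longrightarrow> f u = g u) \<Longrightarrow> mat_op V a f v = mat_op V a g v"
  by (simp add: mat_op_def)

lemma orthonormal_coeff:
  assumes "orthonormal_on V I x" "finite I" "m \<in> I"
  shows "(\<Sum>l\<in>I. d l * inner_on V (x l) (x m)) = d m"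
proof -
  have "(\<Sum>l\<in>I. d l * inner_on V (x l) (x m)) = (\<Sum>l\<in>I. if l = m then d l else 0)"
    using assms by (intro sum.cong) (auto simp: orthonormal_on_def)
  then show ?thesis using assms by simp
qed

text \<open>Gram--Schmidt turns a triangularising basis into an orthonormal one; as a triangular
  symmetric matrix is diagonal, the new basis consists of eigenvectors.\<close>

lemma symmetric_triangular_eigenbasis:
  fixes a :: "'a \<Rightarrow> 'a \<Rightarrow> real"
    and k n :: nat
  assumes V: "finite V" and sym: "\<And>u v. u \<in> V \<Longrightarrow> v \<in> V \<Longrightarrow> a u v = a v u"
    and tri: "\<And>j v. j < n \<Longrightarrow> v \<in> V \<Longrightarrow>
      mat_op V a (p j) v = e j * p j v + (\<Sum>i<j. b i j * p i v)"
    and dual: "\<And>i j. i < n \<Longrightarrow> j < n \<Longrightarrow> inner_on V (q i) (p j) = (if i = j then 1 else 0)"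
  shows "k \<le> n \<Longrightarrow> \<exists>x. orthonormal_on V {..<k} x \<and>
    (\<forall>i<k. \<forall>v\<in>V. mat_op V a (x i) v = e i * x i v) \<and>
    (\<forall>i<k. \<forall>j<n. k \<le> j \<longrightarrow> inner_on V (q j) (x i) = 0) \<and>
    (\<forall>i<k. \<exists>c. \<forall>v\<in>V. p i v = (\<Sum>l<k. c l * x l v))"
proof (induction k)
  case 0
  then show ?case by (auto simp: orthonormal_on_def)
next
  case (Suc k)
  then obtain x where on: "orthonormal_on V {..<k} x"
    and ev: "\<And>i v. i < k \<Longrightarrow> v \<in> V \<Longrightarrow> mat_op V a (x i) v = e i * x i v"
    and qx: "\<And>i j. i < k \<Longrightarrow> j < n \<Longrightarrow> k \<le> j \<Longrightarrow> inner_on V (q j) (x i) = 0"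
    and "\<forall>i<k. \<exists>c. \<forall>v\<in>V. p i v = (\<Sum>l<k. c l * x l v)" by auto
  then obtain c where c: "\<And>i v. i < k \<Longrightarrow> v \<in> V \<Longrightarrow> p i v = (\<Sum>l<k. c i l * x l v)"
    by metis
  have k: "k < n" using Suc.prems by simp
  define g where "g l = inner_on V (p k) (x l)" for l
  define y where "y = (\<lambda>v. p k v - (\<Sum>l<k. g l * x l v))"
  have yx: "inner_on V y (x m) = 0" if "m < k" for m
    using orthonormal_coeff[OF on, of m g] that
    by (simp add: y_def inner_on_linear g_def)
  have qy: "inner_on V (q j) y = (if j = k then 1 else 0)" if "j < n" "k \<le> j" for j
    using that k by (simp add: y_def inner_on_linear qx dual)
  define d where "d l = e k * g l + (\<Sum>i<k. b i k * c i l) - g l * e l" for l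
  have Ty: "mat_op V a y v = e k * y v + (\<Sum>l<k. d l * x l v)" if v: "v \<in> V" for v
  proof -
    have "(\<Sum>i<k. b i k * p i v) = (\<Sum>i<k. \<Sum>l<k. b i k * (c i l * x l v))"
      by (simp add: c v sum_distrib_left)
    also have "\<dots> = (\<Sum>l<k. (\<Sum>i<k. b i k * c i l) * x l v)"
      by (subst sum.swap) (simp add: sum_distrib_right mult.assoc)
    finally have *: "(\<Sum>i<k. b i k * p i v) = (\<Sum>l<k. (\<Sum>i<k. b i k * c i l) * x l v)" .
    have "mat_op V a y v = e k * p k v + (\<Sum>i<k. b i k * p i v) - (\<Sum>l<k. g l * (e l * x l v))"
      unfolding y_def by (simp add: mat_op_diff mat_op_sum mat_op_scale tri k v ev)
    then show ?thesis
      by (simp add: * d_def y_def sum.distrib sum_subtractf algebra_simps sum_distrib_left)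
  qed
  \<comment> \<open>Symmetry moves the operator onto \<open>x m\<close>, where it acts as the scalar
    \<open>e m\<close>, and \<open>y\<close> is orthogonal to \<open>x m\<close>; so the
    off-diagonal part of the triangular relation disappears.\<close>
  have d0: "d m = 0" if m: "m < k" for m
  proof -
    have "inner_on V (mat_op V a y) (x m) = inner_on V (\<lambda>v. e k * y v + (\<Sum>l<k. d l * x l v)) (x m)"
      by (rule inner_on_cong) (auto simp: Ty)
    also have "\<dots> = d m"
      using orthonormal_coeff[OF on, of m d] m by (simp add: inner_on_linear yx)
    finally have "d m = inner_on V y (mat_op V a (x m))"
      using mat_op_symmetric[of V a y "x m"] sym by simp
    also have "\<dots> = inner_on V y (\<lambda>v. e m * x m v)"
      by (rule inner_on_cong) (auto simp: ev m)
    finally show ?thesis by (simp add: inner_on_linear yx m)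
  qed
  have Ty': "mat_op V a y v = e k * y v" if "v \<in> V" for v
    using Ty[OF that] d0 by simp
  \<comment> \<open>The dual family plays the part of linear independence: \<open>q k\<close>
    annihilates every earlier \<open>x i\<close> but pairs to 1 with \<open>p k\<close>, so the
    residual cannot vanish.\<close>
  have "\<exists>v\<in>V. y v \<noteq> 0"
  proof (rule ccontr)
    assume "\<not> ?thesis"
    then have "inner_on V (q k) y = 0" by (simp add: inner_on_def)
    then show False using qy[of k] k by simp
  qed
  then have ypos: "0 < inner_on V y y" using inner_on_pos[OF V] by blast
  define s where "s = sqrt (inner_on V y y)"
  have s: "s > 0" "s * s = inner_on V y y" using ypos by (auto simp: s_def)
  obtain r where r: "r * s = 1" using s(1) by (metis less_irrefl nonzero_divide_eq_eq)
  define x' where "x' = x(k := \<lambda>v. r * y v)"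
  have x'k: "x' k = (\<lambda>v. r * y v)" and x'i: "\<And>i. i < k \<Longrightarrow> x' i = x i"
    by (auto simp: x'_def)
  have on': "orthonormal_on V {..<Suc k} x'"
    unfolding orthonormal_on_def
  proof (intro ballI)
    fix i j assume "i \<in> {..<Suc k}" "j \<in> {..<Suc k}"
    then consider "i < k" "j < k" | "i < k" "j = k" | "i = k" "j < k" | "i = k" "j = k" by force
    then show "inner_on V (x' i) (x' j) = (if i = j then 1 else 0)"
    proof cases
      case 1 then show ?thesis using on by (simp add: x'i orthonormal_on_def)
    next
      case 2 then show ?thesis
        using yx[of i] by (simp add: x'i x'k inner_on_linear inner_on_commute[of V _ y])
    next
      case 3 then show ?thesis using yx[of j] by (simp add: x'i x'k inner_on_linear)
    next
      case 4 
      have "inner_on V (x' k) (x' k) = (r * s) * (r * s)"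
        unfolding x'k by (simp only: inner_on_linear s(2)[symmetric] ac_simps)
      then show ?thesis using 4 r by simp
    qed
  qed
  have span: "\<exists>c. \<forall>v\<in>V. p i v = (\<Sum>l<Suc k. c l * x' l v)" if i: "i < Suc k" for i
  proof (cases "i = k")
    case True
    have "p k v = (\<Sum>l<k. g l * x l v) + s * r * y v" for v
      using r by (simp add: mult.commute y_def)
    with True show ?thesis
      by (intro exI[of _ "g(k := s)"]) (auto simp: x'i x'k mult.assoc)
  next
    case False
    then show ?thesis using i
      by (intro exI[of _ "(c i)(k := 0)"]) (auto simp: x'i c)
  qed
  show ?case
  proof (intro exI[of _ x'] conjI allI impI on' span)
    fix i assume "i < Suc k"
    show "\<forall>v\<in>V. mat_op V a (x' i) v = e i * x' i v"
    proof (cases "i = k")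
      case True then show ?thesis by (auto simp: x'k mat_op_scale Ty')
    next
      case False then show ?thesis using \<open>i < Suc k\<close> by (auto simp: x'i ev)
    qed
  next
    fix i j assume "i < Suc k" "j < n" "Suc k \<le> j"
    then show "inner_on V (q j) (x' i) = 0"
      by (cases "i = k") (simp_all add: x'k x'i inner_on_linear qx qy)
  qed 
qed

subsection \<open>The spectral theorem\<close>

text \<open>Over the complex numbers the polynomial splits. For an eigenvector with eigenvalue
  \<open>a\<close> the Hermitian form is \<open>a\<close> times a positive number, and by symmetry
  it equals its own conjugate, so \<open>a\<close> is real.\<close>

lemma real_symmetric_char_poly_splits:
  fixes A :: "real mat"
  assumes A: "A \<in> carrier_mat n n"
    and sym: "\<And>i j. i < n \<Longrightarrow> j < n \<Longrightarrow> A $$ (i, j) = A $$ (j, i)"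
  shows "\<exists>es. char_poly A = (\<Prod>e\<leftarrow>es. [:- e, 1:]) \<and> length es = n"
proof -
  define C where "C = map_mat complex_of_real A"
  have C: "C \<in> carrier_mat n n" using A by (simp add: C_def)
  have cp: "char_poly C = map_poly complex_of_real (char_poly A)"
    unfolding C_def by (rule of_real_hom.char_poly_hom[OF A])
  obtain as where as: "char_poly C = (\<Prod>a\<leftarrow>as. [:- a, 1:])" and len: "length as = n"
    using char_poly_factorized[OF C] by auto
  have real: "Im a = 0" if a: "a \<in> set as" for a
  proof -
    have "poly (char_poly C) a = 0"
      unfolding as using a by (induction as) auto
    then obtain v where ev: "eigenvector C v a"
      using eigenvalue_root_char_poly[OF C] by (auto simp: eigenvalue_def)
    then have v: "v \<in> carrier_vec n" "v \<noteq> 0\<^sub>v n" and Cv: "C *\<^sub>v v = a \<cdot>\<^sub>v v"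
      using C by (auto simp: eigenvector_def)
    have Cv': "(\<Sum>j<n. of_real (A $$ (i, j)) * v $ j) = a * v $ i" if "i < n" for i
      using arg_cong[OF Cv, of "\<lambda>w. w $ i"] that C v A
      by (auto simp: scalar_prod_def C_def atLeast0LessThan)
    define S where "S = (\<Sum>i<n. \<Sum>j<n. cnj (v $ i) * of_real (A $$ (i, j)) * v $ j)"
    define N where "N = (\<Sum>i<n. (cmod (v $ i))\<^sup>2)"
    have "S = (\<Sum>i<n. cnj (v $ i) * (a * v $ i))"
      unfolding S_def by (intro sum.cong refl) (simp add: Cv'[symmetric] sum_distrib_left mult.assoc)
    also have "\<dots> = a * of_real N"
      unfolding N_def of_real_sum sum_distrib_left
      by (intro sum.cong refl) (simp add: complex_norm_square[symmetric] mult_ac flip: of_real_power)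
    finally have SN: "S = a * of_real N" .
    have "cnj S = (\<Sum>i<n. \<Sum>j<n. v $ i * of_real (A $$ (i, j)) * cnj (v $ j))"
      by (simp add: S_def)
    also have "\<dots> = (\<Sum>j<n. \<Sum>i<n. v $ i * of_real (A $$ (i, j)) * cnj (v $ j))"
      by (rule sum.swap)
    also have "\<dots> = S" unfolding S_def
      by (intro sum.cong refl) (simp add: sym mult.commute mult.left_commute)
    finally have "Im S = 0" by (metis Reals_cnj_iff complex_is_Real_iff)
    then have "Im a * N = 0" unfolding SN by simp
    moreover have "N > 0"
    proof -
      obtain i where "i < n" "v $ i \<noteq> 0" using v by (metis carrier_vecD eq_vecI index_zero_vec)
      then show ?thesis unfolding N_def by (intro sum_pos2[of _ i]) auto
    qed
    ultimately show ?thesis by simp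
  qed
  have "map_poly complex_of_real (\<Prod>e\<leftarrow>map Re as. [:- e, 1:]) = (\<Prod>a\<leftarrow>as. [:- a, 1:])"
    using real
  proof (induction as)
    case (Cons a as)
    have "map_poly complex_of_real (p * q) = map_poly complex_of_real p * map_poly complex_of_real q"
      for p q
      by (intro poly_eqI) (simp add: coeff_map_poly coeff_mult)
    moreover have "map_poly complex_of_real [:- Re a, 1:] = [:- a, 1:]"
      using Cons.prems[of a] by (simp add: map_poly_pCons complex_eq_iff)
    ultimately show ?case using Cons by (simp only: list.map prod_list.Cons list.set_intros)
  qed simp
  then have "map_poly complex_of_real (char_poly A) =
      map_poly complex_of_real (\<Prod>e\<leftarrow>map Re as. [:- e, 1:])"
    using cp as by simp
  then have "char_poly A = (\<Prod>e\<leftarrow>map Re as. [:- e, 1:])"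
    by (metis (no_types, lifting) coeff_map_poly of_real_0 of_real_eq_iff poly_eqI)
  then show ?thesis using len by (intro exI[of _ "map Re as"]) simp
qed

text \<open>A single list \<open>es\<close> serves as root multiset and as the eigenvalues of the
  basis: this turns algebraic multiplicity into a number of orthonormal eigenfunctions. Schur
  decomposition supplies it, as the diagonal of a triangular matrix.\<close>

lemma real_symmetric_eigenbasis:
  fixes A :: "real mat"
  assumes A: "A \<in> carrier_mat n n"
    and sym: "\<And>i j. i < n \<Longrightarrow> j < n \<Longrightarrow> A $$ (i, j) = A $$ (j, i)"
  obtains es x where "length es = n" "proots (char_poly A) = mset es"
    "orthonormal_on {..<n} {..<n} x"
    "\<And>i v. i < n \<Longrightarrow> v < n \<Longrightarrow> mat_op {..<n} (\<lambda>i j. A $$ (i, j)) (x i) v = es ! i * x i v"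
proof -
  obtain es where es: "char_poly A = (\<Prod>e\<leftarrow>es. [:- e, 1:])" and len: "length es = n"
    using real_symmetric_char_poly_splits[OF assms] by auto
  have roots: "proots (char_poly A) = mset es"
    unfolding es
  proof (induction es)
    case (Cons e es)
    have "(\<Prod>e\<leftarrow>es. [:- e, 1:]) \<noteq> 0" by (auto simp: prod_list_zero_iff)
    then have "proots ([:- e, 1:] * (\<Prod>e\<leftarrow>es. [:- e, 1:])) = {#e#} + proots (\<Prod>e\<leftarrow>es. [:- e, 1:])"
      by (subst proots_mult) auto
    then show ?case using Cons by simp
  qed simp
  obtain B P Q where "schur_decomposition A es = (B, P, Q)" by (metis prod_cases3)
  then have sim: "similar_mat_wit A B P Q" and ut: "upper_triangular B" and diag: "diag_mat B = es"
    using schur_decomposition[OF A es] by auto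
  note w = similar_mat_witD2[OF A sim]
  \<comment> \<open>Read column by column this is the triangular relation for the columns of
    \<open>P\<close>; the rows of the inverse \<open>Q\<close> form the dual family.\<close>
  have AP: "A * P = P * B"
  proof -
    have "A * P = P * B * (Q * P)"
      using w(4-7) by (subst w(3)) (simp add: assoc_mult_mat[of _ n n _ n _ n])
    then show ?thesis using w(2,5,6) by simp
  qed
  have tri: "mat_op {..<n} (\<lambda>i j. A $$ (i, j)) (\<lambda>k. P $$ (k, j)) v
      = es ! j * P $$ (v, j) + (\<Sum>i<j. B $$ (i, j) * P $$ (v, i))" if j: "j < n" and v: "v \<in> {..<n}" for j v
  proof -
    have "mat_op {..<n} (\<lambda>i j. A $$ (i, j)) (\<lambda>k. P $$ (k, j)) v = (A * P) $$ (v, j)"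
      using w j v by (simp add: mat_op_def scalar_prod_def atLeast0LessThan)
    also have "\<dots> = (\<Sum>i<n. P $$ (v, i) * B $$ (i, j))"
      unfolding AP using w j v by (simp add: scalar_prod_def atLeast0LessThan)
    also have "\<dots> = (\<Sum>i<Suc j. P $$ (v, i) * B $$ (i, j))"
      using j ut w by (intro sum.mono_neutral_right) (auto simp: upper_triangular_def)
    also have "\<dots> = (\<Sum>i<j. P $$ (v, i) * B $$ (i, j)) + P $$ (v, j) * B $$ (j, j)" by simp
    also have "B $$ (j, j) = es ! j" using diag j w(5) by (auto simp: diag_mat_def)
    finally show ?thesis by (simp add: mult.commute)
  qed
  have dual: "inner_on {..<n} (\<lambda>k. Q $$ (i, k)) (\<lambda>k. P $$ (k, j)) = (if i = j then 1 else 0)"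
    if "i < n" "j < n" for i j
  proof -
    have "inner_on {..<n} (\<lambda>k. Q $$ (i, k)) (\<lambda>k. P $$ (k, j)) = (Q * P) $$ (i, j)"
      using w(4-7) that by (simp add: inner_on_def scalar_prod_def atLeast0LessThan)
    then show ?thesis using w(2) that by simp
  qed
  from symmetric_triangular_eigenbasis[where V = "{..<n}" and n = n and k = n
      and a = "\<lambda>i j. A $$ (i, j)" and e = "\<lambda>j. es ! j"
      and p = "\<lambda>j k. P $$ (k, j)" and q = "\<lambda>i k. Q $$ (i, k)" and b = "\<lambda>i j. B $$ (i, j)",
      OF _ _ tri dual] sym
  obtain x where "orthonormal_on {..<n} {..<n} x"
    "\<forall>i<n. \<forall>v\<in>{..<n}. mat_op {..<n} (\<lambda>i j. A $$ (i, j)) (x i) v = es ! i * x i v"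
    by auto
  with len roots show ?thesis by (intro that[of es x]) auto
qed

text \<open>A one-sided inverse of a square matrix is two-sided, so orthonormal rows force
  orthonormal columns.\<close>

lemma orthonormal_on_complete:
  assumes on: "orthonormal_on {..<n} {..<n} x" and k: "k < n" and l: "l < (n::nat)"
  shows "(\<Sum>i<n. x i k * x i l) = (if k = l then 1 else 0)"
proof -
  define P where "P = mat n n (\<lambda>(i, k). x i k)"
  have P: "P \<in> carrier_mat n n" by (simp add: P_def)
  have "P * transpose_mat P = 1\<^sub>m n"
    using on by (intro eq_matI)
      (auto simp: P_def scalar_prod_def orthonormal_on_def inner_on_def atLeast0LessThan)
  then have "transpose_mat P * P = 1\<^sub>m n"
    by (rule mat_mult_left_right_inverse[OF P, rotated]) (simp add: P)
  then have "(transpose_mat P * P) $$ (k, l) = 1\<^sub>m n $$ (k, l)" by (rule arg_cong)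
  moreover have "(transpose_mat P * P) $$ (k, l) = (\<Sum>i<n. x i k * x i l)"
    using k l by (simp add: P_def scalar_prod_def atLeast0LessThan)
  ultimately show ?thesis using k l by simp
qed

lemma orthonormal_on_expand:
  assumes "orthonormal_on {..<n} {..<n} x" "k < (n::nat)"
  shows "f k = (\<Sum>i<n. inner_on {..<n} f (x i) * x i k)"
proof -
  have "(\<Sum>i<n. inner_on {..<n} f (x i) * x i k) = (\<Sum>i<n. \<Sum>l<n. f l * (x i l * x i k))"
    by (simp add: inner_on_def sum_distrib_right mult.assoc)
  also have "\<dots> = (\<Sum>l<n. f l * (\<Sum>i<n. x i l * x i k))"
    by (subst sum.swap) (simp add: sum_distrib_left)
  also have "\<dots> = (\<Sum>l<n. if l = k then f l else 0)"
    by (intro sum.cong refl) (simp add: orthonormal_on_complete[OF assms(1) _ assms(2)])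
  finally show ?thesis using assms(2) by simp
qed

subsection \<open>Eigenfunctions and traces\<close>

lemma homogeneous_system_nontrivial:
  fixes M :: "'k \<Rightarrow> 'j \<Rightarrow> real"
  assumes "finite K" "finite J" "card K < card J"
  shows "\<exists>c. (\<exists>j\<in>J. c j \<noteq> 0) \<and> (\<forall>k\<in>K. (\<Sum>j\<in>J. M k j * c j) = 0)"
  using assms
proof (induction K arbitrary: J M)
  case empty
  then have "J \<noteq> {}" by auto
  then show ?case by (intro exI[of _ "\<lambda>_. 1"]) auto
next
  case (insert k K)
  show ?case
  proof (cases "\<forall>j\<in>J. M k j = 0")
    case True
    have "card K < card J" using insert by simp
    from insert.IH[OF insert.prems(1) this] obtain c
      where "\<exists>j\<in>J. c j \<noteq> 0" "\<forall>k\<in>K. (\<Sum>j\<in>J. M k j * c j) = 0" by blast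
    with True show ?thesis by (intro exI[of _ c]) auto
  next
    case False
    then obtain j0 where j0: "j0 \<in> J" "M k j0 \<noteq> 0" by auto
    \<comment> \<open>Gaussian elimination: equation \<open>k\<close> is solved for the unknown
      \<open>j0\<close> and substituted into the others, leaving one equation and one unknown
      fewer.\<close>
    define J' where "J' = J - {j0}"
    have J: "finite J'" "card K < card J'" "J = insert j0 J'" "j0 \<notin> J'"
      using insert j0 by (auto simp: J'_def)
    obtain c where c: "\<exists>j\<in>J'. c j \<noteq> 0"
      "\<And>i. i \<in> K \<Longrightarrow> (\<Sum>j\<in>J'. (M i j - M i j0 * M k j / M k j0) * c j) = 0"
      using insert.IH[OF J(1,2), of "\<lambda>i j. M i j - M i j0 * M k j / M k j0"] by blast
    define s where "s = (\<Sum>j\<in>J'. M k j * c j)"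
    define d where "d = c(j0 := - s / M k j0)"
    have sum: "(\<Sum>j\<in>J. M i j * d j) = M i j0 * (- s / M k j0) + (\<Sum>j\<in>J'. M i j * c j)" for i
    proof -
      have "(\<Sum>j\<in>J'. M i j * d j) = (\<Sum>j\<in>J'. M i j * c j)"
        by (intro sum.cong) (use J in \<open>auto simp: d_def\<close>)
      then show ?thesis using J by (simp add: d_def)
    qed
    have "(\<Sum>j\<in>J. M i j * d j) = 0" if "i \<in> insert k K" for i
    proof (cases "i = k")
      case True
      then show ?thesis using j0 by (simp add: sum s_def)
    next
      case False
      then have "0 = (\<Sum>j\<in>J'. M i j * c j - (M i j0 / M k j0) * (M k j * c j))"
        using c(2)[of i] that by (simp add: algebra_simps)
      also have "\<dots> = (\<Sum>j\<in>J'. M i j * c j) - (M i j0 / M k j0) * s"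
        by (simp only: sum_subtractf sum_distrib_left s_def)
      finally show ?thesis by (simp add: sum)
    qed
    moreover have "\<exists>j\<in>J. d j \<noteq> 0" using c(1) J by (auto simp: d_def)
    ultimately show ?thesis by blast
  qed
qed

text \<open>Dimension count: the next function has to meet \<open>card W\<close> vanishing and
  \<open>t\<close> orthogonality conditions, fewer than its \<open>card J\<close> free
  coefficients.\<close>

lemma orthonormal_combinations_vanishing:
  assumes V: "finite V" and W: "finite W" and J: "finite J" and on: "orthonormal_on V J x"
  shows "t + card W \<le> card J \<Longrightarrow> \<exists>y. orthonormal_on V {..<t::nat} y \<and>
    (\<forall>i<t. (\<exists>c. y i = (\<lambda>v. \<Sum>j\<in>J. c j * x j v)) \<and> (\<forall>w\<in>W. y i w = 0))"
proof (induction t)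
  case 0
  then show ?case by (simp add: orthonormal_on_def)
next
  case (Suc t)
  then obtain y where ony: "orthonormal_on V {..<t} y"
    and y: "\<And>i. i < t \<Longrightarrow> \<exists>c. y i = (\<lambda>v. \<Sum>j\<in>J. c j * x j v)"
    and yW: "\<And>i w. i < t \<Longrightarrow> w \<in> W \<Longrightarrow> y i w = 0" by auto
  define M where "M k j = (case k of Inl w \<Rightarrow> x j w | Inr i \<Rightarrow> inner_on V (y i) (x j))" for k j
  have "card (W <+> {..<t}) < card J" using W Suc.prems by (simp add: card_Plus)
  from homogeneous_system_nontrivial[OF _ J this, of M] W
  obtain c where c0: "\<exists>j\<in>J. c j \<noteq> 0" and c: "\<And>k. k \<in> W <+> {..<t} \<Longrightarrow> (\<Sum>j\<in>J. M k j * c j) = 0"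
    by auto
  define f where "f = (\<lambda>v. \<Sum>j\<in>J. c j * x j v)"
  have fW: "f w = 0" if "w \<in> W" for w
    using c[of "Inl w"] that by (auto simp: M_def f_def mult.commute)
  have fy: "inner_on V (y i) f = 0" if "i < t" for i
    using c[of "Inr i"] that by (auto simp: M_def f_def inner_on_linear mult.commute)
  obtain m where m: "m \<in> J" "c m \<noteq> 0" using c0 by auto
  have "inner_on V f (x m) = c m"
    using orthonormal_coeff[OF on J m(1), of c] by (simp add: f_def inner_on_linear)
  then have "\<exists>v\<in>V. f v \<noteq> 0" using m(2) unfolding inner_on_def
    by (metis (mono_tags, lifting) mult_zero_left sum.neutral)
  then have "inner_on V f f > 0" using inner_on_pos[OF V] by blast
  then have "\<exists>r. r * r * inner_on V f f = 1"
    by (intro exI[of _ "1 / sqrt (inner_on V f f)"]) (simp add: field_simps)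
  then obtain r where r: "r * r * inner_on V f f = 1" by blast
  define y' where "y' = y(t := \<lambda>v. r * f v)"
  have y't: "y' t = (\<lambda>v. r * f v)" and y'i: "\<And>i. i < t \<Longrightarrow> y' i = y i" by (auto simp: y'_def)
  have "orthonormal_on V {..<Suc t} y'"
    unfolding orthonormal_on_def
  proof (intro ballI)
    fix i j assume "i \<in> {..<Suc t}" "j \<in> {..<Suc t}"
    then consider "i < t" "j < t" | "i < t" "j = t" | "i = t" "j < t" | "i = t" "j = t" by force
    then show "inner_on V (y' i) (y' j) = (if i = j then 1 else 0)"
    proof cases
      case 1 then show ?thesis using ony by (simp add: y'i orthonormal_on_def)
    next
      case 2 then show ?thesis using fy by (simp add: y'i y't inner_on_linear)
    next
      case 3 then show ?thesis using fy by (simp add: y'i y't inner_on_linear inner_on_commute[of V f "y j"])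
    next
      case 4 then show ?thesis using r by (simp add: y't inner_on_linear mult.assoc)
    qed
  qed
  moreover have "\<exists>c. y' i = (\<lambda>v. \<Sum>j\<in>J. c j * x j v)" if "i < Suc t" for i
  proof (cases "i = t")
    case True
    have "y' t = (\<lambda>v. \<Sum>j\<in>J. (r * c j) * x j v)" by (simp add: y't f_def sum_distrib_left mult.assoc)
    then show ?thesis using True by (intro exI[of _ "\<lambda>j. r * c j"]) simp
  next
    case False then show ?thesis using that y[of i] y'i[of i] by simp
  qed
  moreover have "y' i w = 0" if "i < Suc t" "w \<in> W" for i w
    using that fW yW by (cases "i = t") (auto simp: y't y'i)
  ultimately show ?case by blast
qed

lemma bessel_inequality:
  assumes on: "orthonormal_on V {..<t::nat} y"
  shows "(\<Sum>i<t. (inner_on V f (y i))\<^sup>2) \<le> inner_on V f f"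
proof -
  define g where "g = (\<lambda>v. f v - (\<Sum>i<t. inner_on V f (y i) * y i v))"
  have gy: "inner_on V g (y m) = 0" if "m < t" for m
    using orthonormal_coeff[OF on, of m "\<lambda>i. inner_on V f (y i)"] that
    by (simp add: g_def inner_on_linear)
  have yf: "inner_on V (y i) f = inner_on V f (y i)" for i by (rule inner_on_commute)
  have "inner_on V g g = inner_on V g f - (\<Sum>i<t. inner_on V f (y i) * inner_on V g (y i))"
    by (subst (2) g_def) (simp add: inner_on_linear)
  also have "\<dots> = inner_on V g f" by (simp add: gy)
  also have "\<dots> = inner_on V f f - (\<Sum>i<t. (inner_on V f (y i))\<^sup>2)"
    by (simp add: g_def inner_on_linear power2_eq_square yf)
  finally show ?thesis using inner_on_nonneg[of V g] by simp
qed

text \<open>The operator of the submatrix on \<open>S\<close>, extended by zero, so that all induced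
  subgraphs act on the same functions with the same inner product.\<close>

definition restr_op :: "'a set \<Rightarrow> ('a \<Rightarrow> 'a \<Rightarrow> real) \<Rightarrow> ('a \<Rightarrow> real) \<Rightarrow> 'a \<Rightarrow> real" where
  "restr_op S a f v = (if v \<in> S then mat_op S a f v else 0)"

definition point_mass :: "'a \<Rightarrow> 'a \<Rightarrow> real" where
  "point_mass u v = (if v = u then 1 else 0)"

lemma inner_on_point_mass:
  assumes "finite V" "v \<in> V"
  shows "inner_on V (point_mass v) f = f v" "inner_on V f (point_mass v) = f v"
proof -
  have "inner_on V (point_mass v) f = (\<Sum>u\<in>V. if u = v then f u else 0)"
    unfolding inner_on_def point_mass_def by (intro sum.cong) auto
  then show "inner_on V (point_mass v) f = f v" using assms by simp
  then show "inner_on V f (point_mass v) = f v" by (simp add: inner_on_commute)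
qed

lemma inner_on_restr_op:
  assumes "finite V" "S \<subseteq> V"
  shows "inner_on V (restr_op S a f) g = inner_on S (mat_op S a f) g"
    "inner_on V g (restr_op S a f) = inner_on S g (mat_op S a f)"
proof -
  show "inner_on V (restr_op S a f) g = inner_on S (mat_op S a f) g"
    unfolding inner_on_def restr_op_def using assms by (intro sum.mono_neutral_cong_right) auto
  then show "inner_on V g (restr_op S a f) = inner_on S g (mat_op S a f)"
    by (simp add: inner_on_commute)
qed

lemma restr_op_symmetric:
  assumes "finite V" "S \<subseteq> V" "\<And>u v. u \<in> V \<Longrightarrow> v \<in> V \<Longrightarrow> a u v = a v u"
  shows "inner_on V (restr_op S a f) g = inner_on V f (restr_op S a g)"
  using assms by (simp add: inner_on_restr_op subset_iff mat_op_symmetric)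

lemma restr_op_power_symmetric:
  assumes "finite V" "S \<subseteq> V" "\<And>u v. u \<in> V \<Longrightarrow> v \<in> V \<Longrightarrow> a u v = a v u"
  shows "inner_on V ((restr_op S a ^^ k) f) g = inner_on V f ((restr_op S a ^^ k) g)"
proof (induction k arbitrary: g)
  case (Suc k)
  have "inner_on V ((restr_op S a ^^ Suc k) f) g = inner_on V ((restr_op S a ^^ k) f) (restr_op S a g)"
    by (simp add: restr_op_symmetric assms)
  also have "\<dots> = inner_on V f ((restr_op S a ^^ Suc k) g)"
    by (simp add: Suc.IH flip: funpow_swap1)
  finally show ?case .
qed simp

text \<open>Half of the power moves across by symmetry. A number of closed walks thus becomes a
  squared norm, which Bessel's inequality bounds from below and the local spectral radius from
  above.\<close>

lemma restr_op_even_power_diagonal: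
  assumes "finite V" "S \<subseteq> V" "\<And>u v. u \<in> V \<Longrightarrow> v \<in> V \<Longrightarrow> a u v = a v u" "v \<in> V"
  shows "(restr_op S a ^^ (2 * k)) (point_mass v) v =
    inner_on V ((restr_op S a ^^ k) (point_mass v)) ((restr_op S a ^^ k) (point_mass v))"
proof -
  have "(restr_op S a ^^ (2 * k)) (point_mass v) v =
      inner_on V (point_mass v) ((restr_op S a ^^ (2 * k)) (point_mass v))"
    using assms by (simp add: inner_on_point_mass)
  also have "\<dots> = inner_on V (point_mass v) ((restr_op S a ^^ k) ((restr_op S a ^^ k) (point_mass v)))"
    by (simp add: mult_2 funpow_add)
  finally show ?thesis by (simp only: restr_op_power_symmetric[OF assms(1-3)])
qed

text \<open>For a nonnegative matrix the quadratic form at \<open>h\<close> is at least minus the one at \<open>\<bar>h\<bar>\<close>,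
  so an upper bound on the form is a two-sided one and, by polarisation, a bound on the norm.\<close>

lemma restr_op_norm_bound:
  assumes V: "finite V" "B \<subseteq> V" and sym: "\<And>u v. u \<in> V \<Longrightarrow> v \<in> V \<Longrightarrow> a u v = a v u"
    and nonneg: "\<And>u v. 0 \<le> a u v" and l: "0 < l"
    and form: "\<And>f. inner_on V f (restr_op B a f) \<le> l * inner_on V f f"
  shows "inner_on V (restr_op B a f) (restr_op B a f) \<le> l\<^sup>2 * inner_on V f f"
proof -
  let ?C = "restr_op B a"
  have lower: "- (l * inner_on V h h) \<le> inner_on V h (?C h)" for h
  proof -
    have form_eq: "inner_on V g (?C g) = (\<Sum>v\<in>B. \<Sum>u\<in>B. g v * (a v u * g u))" for g
      unfolding inner_on_restr_op[OF V] by (simp add: inner_on_def mat_op_def sum_distrib_left)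
    have le: "- (h v * (a v u * h u)) \<le> \<bar>h v\<bar> * (a v u * \<bar>h u\<bar>)" for u v
    proof -
      have "- (h v * (a v u * h u)) \<le> \<bar>h v * (a v u * h u)\<bar>" by linarith
      also have "\<dots> = \<bar>h v\<bar> * (a v u * \<bar>h u\<bar>)" using nonneg by (simp add: abs_mult)
      finally show ?thesis .
    qed
    have "- inner_on V h (?C h) = (\<Sum>v\<in>B. \<Sum>u\<in>B. - (h v * (a v u * h u)))"
      by (simp add: form_eq sum_negf)
    also have "\<dots> \<le> inner_on V (\<lambda>v. \<bar>h v\<bar>) (?C (\<lambda>v. \<bar>h v\<bar>))"
      unfolding form_eq by (intro sum_mono le)
    also have "\<dots> \<le> l * inner_on V h h"
      using form[of "\<lambda>v. \<bar>h v\<bar>"] by (simp add: inner_on_def flip: abs_mult)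
    finally show ?thesis by simp
  qed
  have lin: "?C (\<lambda>v. f v + g v) = (\<lambda>v. ?C f v + ?C g v)" "?C (\<lambda>v. f v - g v) = (\<lambda>v. ?C f v - ?C g v)" for f g
    by (auto simp: restr_op_def mat_op_add mat_op_diff)
  have polar: "2 * inner_on V g (?C f) \<le> l * (inner_on V f f + inner_on V g g)" for g
  proof -
    have "4 * inner_on V g (?C f) =
      inner_on V (\<lambda>v. g v + f v) (?C (\<lambda>v. g v + f v)) - inner_on V (\<lambda>v. g v - f v) (?C (\<lambda>v. g v - f v))"
      using restr_op_symmetric[of V B a g f, OF V sym]
      by (simp add: lin inner_on_linear inner_on_commute[of V "?C g" f])
    also have "\<dots> \<le> l * inner_on V (\<lambda>v. g v + f v) (\<lambda>v. g v + f v) + l * inner_on V (\<lambda>v. g v - f v) (\<lambda>v. g v - f v)"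
      using form[of "\<lambda>v. g v + f v"] lower[of "\<lambda>v. g v - f v"] by linarith
    also have "\<dots> = 2 * (l * (inner_on V f f + inner_on V g g))"
      by (simp add: inner_on_linear inner_on_commute[of V g f] algebra_simps)
    finally show ?thesis by linarith
  qed
  \<comment> \<open>The choice \<open>g = ?C f / l\<close> puts the squared norm of
    \<open>?C f\<close> on both sides of \<open>polar\<close>, with weights \<open>2 / l\<close> and
    \<open>1 / l\<close>.\<close>
  have "2 * ((1 / l) * inner_on V (?C f) (?C f)) \<le>
      l * (inner_on V f f + (1 / l) * ((1 / l) * inner_on V (?C f) (?C f)))"
    using polar[of "\<lambda>v. (1 / l) * ?C f v"] by (simp only: inner_on_linear)
  then show ?thesis using l by (simp add: field_simps power2_eq_square)
qed

lemma restr_op_power_norm_bound: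
  assumes bound: "\<And>f. inner_on V (restr_op B a f) (restr_op B a f) \<le> l\<^sup>2 * inner_on V f f"
  shows "inner_on V ((restr_op B a ^^ k) f) ((restr_op B a ^^ k) f) \<le> l ^ (2 * k) * inner_on V f f"
proof (induction k)
  case (Suc k)
  have "inner_on V ((restr_op B a ^^ Suc k) f) ((restr_op B a ^^ Suc k) f)
      \<le> l\<^sup>2 * inner_on V ((restr_op B a ^^ k) f) ((restr_op B a ^^ k) f)"
    using bound by simp
  also have "\<dots> \<le> l\<^sup>2 * (l ^ (2 * k) * inner_on V f f)"
    using Suc by (intro mult_left_mono) auto
  finally show ?case by (simp add: power2_eq_square)
qed simp

text \<open>At least \<open>card J - card W\<close> orthonormal combinations of the eigenfunctions vanish on \<open>W\<close> and
  are therefore eigenfunctions of what remains after deleting \<open>W\<close>.\<close>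

lemma eigenfunctions_card_le_trace:
  assumes V: "finite V" and W: "W \<subseteq> V" and J: "finite J"
    and sym: "\<And>u v. u \<in> V \<Longrightarrow> v \<in> V \<Longrightarrow> a u v = a v u"
    and on: "orthonormal_on V J x" and ev: "\<And>j v. j \<in> J \<Longrightarrow> v \<in> V \<Longrightarrow> mat_op V a (x j) v = l * x j v"
  shows "(real (card J) - real (card W)) * l ^ (2 * k)
    \<le> (\<Sum>v\<in>V - W. (restr_op (V - W) a ^^ (2 * k)) (point_mass v) v)"
proof -
  let ?S = "V - W"
  let ?C = "restr_op ?S a"
  define t where "t = card J - card W"
  have S: "?S \<subseteq> V" by auto
  have finW: "finite W" using V W by (rule rev_finite_subset)
  have nonneg: "0 \<le> (\<Sum>v\<in>?S. (?C ^^ (2 * k)) (point_mass v) v)"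
    using restr_op_even_power_diagonal[OF V S sym] by (intro sum_nonneg) (simp add: inner_on_nonneg)
  show ?thesis
  proof (cases "card W \<le> card J")
    case False
    then have "(real (card J) - real (card W)) * l ^ (2 * k) \<le> 0"
      by (intro mult_nonpos_nonneg) auto
    with nonneg show ?thesis by linarith
  next
    case True
    then have "t + card W \<le> card J" by (simp add: t_def)
    from orthonormal_combinations_vanishing[OF V finW J on this] obtain y
      where ony: "orthonormal_on V {..<t} y" and y: "\<And>i. i < t \<Longrightarrow> \<exists>c. y i = (\<lambda>v. \<Sum>j\<in>J. c j * x j v)"
        and yW: "\<And>i w. i < t \<Longrightarrow> w \<in> W \<Longrightarrow> y i w = 0" by auto
    have Ty: "mat_op V a (y i) v = l * y i v" if "i < t" "v \<in> V" for i v
    proof -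
      obtain c where "y i = (\<lambda>v. \<Sum>j\<in>J. c j * x j v)" using y \<open>i < t\<close> by auto
      then show ?thesis using ev that(2)
        by (simp add: mat_op_sum mat_op_scale sum_distrib_left mult.left_commute)
    qed
    \<comment> \<open>Off \<open>V\<close> the combinations take arbitrary values. Cutting them off
      makes the eigenvalue equation for \<open>?C\<close> an equality of functions, which can be
      iterated.\<close>
    define z where "z i v = (if v \<in> ?S then y i v else 0)" for i v
    have zy: "z i v = y i v" if "i < t" "v \<in> V" for i v
      using that yW by (auto simp: z_def)
    have "inner_on V (z i) (z j) = inner_on V (y i) (y j)" if "i < t" "j < t" for i j
      using that by (intro inner_on_cong) (auto simp: zy)
    then have onz: "orthonormal_on V {..<t} z" using ony by (simp add: orthonormal_on_def)
    have Cz: "?C (z i) = (\<lambda>v. l * z i v)" if "i < t" for i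
    proof
      fix v
      show "?C (z i) v = l * z i v"
      proof (cases "v \<in> ?S")
        case True
        have "mat_op ?S a (z i) v = mat_op V a (y i) v"
          unfolding mat_op_def using V that yW by (intro sum.mono_neutral_cong_left) (auto simp: z_def)
        then show ?thesis using True Ty that by (simp add: restr_op_def z_def)
      qed (auto simp: restr_op_def z_def)
    qed
    have scale: "?C (\<lambda>v. c * f v) = (\<lambda>v. c * ?C f v)" for c f
      by (auto simp: restr_op_def mat_op_scale)
    have Ckz: "(?C ^^ k) (z i) = (\<lambda>v. l ^ k * z i v)" if "i < t" for i
      by (induction k) (simp_all add: scale Cz that mult_ac)
    have "real t * l ^ (2 * k) = (\<Sum>i<t. l ^ (2 * k) * inner_on V (z i) (z i))"
      using onz by (simp add: orthonormal_on_def)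
    also have "\<dots> = (\<Sum>i<t. \<Sum>v\<in>?S. (l ^ k * z i v)\<^sup>2)"
    proof (intro sum.cong refl)
      fix i
      have "inner_on V (z i) (z i) = (\<Sum>v\<in>?S. (z i v)\<^sup>2)"
        unfolding inner_on_def using V by (intro sum.mono_neutral_cong_right) (auto simp: z_def power2_eq_square)
      then show "l ^ (2 * k) * inner_on V (z i) (z i) = (\<Sum>v\<in>?S. (l ^ k * z i v)\<^sup>2)"
        by (simp add: sum_distrib_left power_mult_distrib mult.commute flip: power_mult)
    qed
    \<comment> \<open>From here on the comparison runs vertex by vertex:
      \<open>l ^ k * z i v\<close> is the coefficient at \<open>z i\<close> of the
      \<open>k\<close>-th power applied to the point mass at \<open>v\<close>, and Bessel bounds the
      sum of their squares.\<close>
    also have "\<dots> = (\<Sum>v\<in>?S. \<Sum>i<t. (l ^ k * z i v)\<^sup>2)" by (rule sum.swap)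
    also have "\<dots> \<le> (\<Sum>v\<in>?S. (?C ^^ (2 * k)) (point_mass v) v)"
    proof (intro sum_mono)
      fix v assume v: "v \<in> ?S"
      have "inner_on V ((?C ^^ k) (point_mass v)) (z i) = l ^ k * z i v" if "i < t" for i
        using v by (simp add: restr_op_power_symmetric[OF V S sym] Ckz that inner_on_point_mass V)
      then have "(\<Sum>i<t. (l ^ k * z i v)\<^sup>2) = (\<Sum>i<t. (inner_on V ((?C ^^ k) (point_mass v)) (z i))\<^sup>2)"
        by simp
      also have "\<dots> \<le> inner_on V ((?C ^^ k) (point_mass v)) ((?C ^^ k) (point_mass v))"
        by (rule bessel_inequality[OF onz])
      also have "\<dots> = (?C ^^ (2 * k)) (point_mass v) v"
        using v by (subst restr_op_even_power_diagonal[OF V S sym]) auto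
      finally show "(\<Sum>i<t. (l ^ k * z i v)\<^sup>2) \<le> (?C ^^ (2 * k)) (point_mass v) v" .
    qed
    finally show ?thesis using True by (simp add: t_def of_nat_diff)
  qed
qed

subsection \<open>Closed walks and random deletion\<close>

definition adj :: "('a \<Rightarrow> 'a \<Rightarrow> bool) \<Rightarrow> 'a \<Rightarrow> 'a \<Rightarrow> real" where
  "adj E u v = (if E u v then 1 else 0)"

lemma adj_nonneg: "0 \<le> adj E u v"
  by (simp add: adj_def)

text \<open>The list omits the starting vertex, so its length is the number of steps; a closed walk
  of positive length repeats its base point as the last entry.\<close>

fun walk :: "('a \<Rightarrow> 'a \<Rightarrow> bool) \<Rightarrow> 'a set \<Rightarrow> 'a \<Rightarrow> 'a list \<Rightarrow> 'a \<Rightarrow> bool" where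
  "walk E S v [] w \<longleftrightarrow> v = w \<and> v \<in> S"
| "walk E S v (x # xs) w \<longleftrightarrow> v \<in> S \<and> E v x \<and> walk E S x xs w"

lemma walk_start: "walk E S v xs w \<Longrightarrow> v \<in> S"
  by (cases xs) auto

lemma walk_set: "walk E S v xs w \<Longrightarrow> x \<in> set xs \<Longrightarrow> x \<in> S"
  by (induction xs arbitrary: v) (auto dest: walk_start)

text \<open>Deleting vertices merely filters walks by their support, so one set of walks can be
  fixed before the deleted set is chosen.\<close>

lemma walk_subset_iff:
  assumes "S \<subseteq> T"
  shows "walk E S v xs w \<longleftrightarrow> walk E T v xs w \<and> insert v (set xs) \<subseteq> S"
  using assms by (induction xs arbitrary: v) auto

lemma finite_walks:
  assumes "finite S"
  shows "finite {xs. length xs = k \<and> walk E S v xs w}"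
proof (rule finite_subset)
  show "{xs. length xs = k \<and> walk E S v xs w} \<subseteq> {xs. set xs \<subseteq> S \<and> length xs = k}"
    by (auto dest: walk_set)
qed (rule finite_lists_length_eq[OF assms])

lemma card_walks:
  assumes S: "finite S" and w: "w \<in> S"
  shows "real (card {xs. length xs = k \<and> walk E S v xs w}) = (restr_op S (adj E) ^^ k) (point_mass w) v"
proof (induction k arbitrary: v)
  case 0
  have "{xs. length xs = 0 \<and> walk E S v xs w} = (if v = w then {[]} else {})" using w by auto
  then show ?case by (simp add: point_mass_def)
next
  case (Suc k)
  let ?A = "\<lambda>v. {xs. length xs = k \<and> walk E S v xs w}"
  show ?case
  proof (cases "v \<in> S")
    case True
    have eq: "{xs. length xs = Suc k \<and> walk E S v xs w} = (\<Union>x\<in>{x \<in> S. E v x}. (#) x ` ?A x)"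
      using True by (auto simp: length_Suc_conv image_iff dest: walk_start)
    have "card {xs. length xs = Suc k \<and> walk E S v xs w} = (\<Sum>x\<in>{x \<in> S. E v x}. card ((#) x ` ?A x))"
      unfolding eq using S by (intro card_UN_disjoint) (auto simp: finite_walks)
    also have "\<dots> = (\<Sum>x\<in>{x \<in> S. E v x}. card (?A x))"
      by (intro sum.cong refl card_image) auto
    finally have "real (card {xs. length xs = Suc k \<and> walk E S v xs w}) =
        (\<Sum>x\<in>{x \<in> S. E v x}. (restr_op S (adj E) ^^ k) (point_mass w) x)"
      by (simp add: Suc.IH)
    also have "\<dots> = (\<Sum>x\<in>S. adj E v x * (restr_op S (adj E) ^^ k) (point_mass w) x)"
      using S by (intro sum.mono_neutral_cong_left) (auto simp: adj_def)
    finally show ?thesis using True by (simp add: restr_op_def[of S _ _ v] mat_op_def)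
  next
    case False
    then have "{xs. length xs = Suc k \<and> walk E S v xs w} = {}" by (auto dest: walk_start)
    then have "real (card {xs. length xs = Suc k \<and> walk E S v xs w}) = 0" by (simp only: card.empty of_nat_0)
    then show ?thesis using False by (simp add: restr_op_def[of S _ _ v])
  qed
qed

lemma card_UN_image_le:
  assumes "finite I" "\<And>i. i \<in> I \<Longrightarrow> finite (A i)" "\<And>i. i \<in> I \<Longrightarrow> real (card (A i)) \<le> b"
  shows "real (card (\<Union>i\<in>I. f i ` A i)) \<le> real (card I) * b"
proof -
  have "card (\<Union>i\<in>I. f i ` A i) \<le> (\<Sum>i\<in>I. card (A i))"
    using assms(1,2) by (intro order.trans[OF card_UN_le] sum_mono card_image_le) auto
  then have "real (card (\<Union>i\<in>I. f i ` A i)) \<le> (\<Sum>i\<in>I. real (card (A i)))" by (simp flip: of_nat_sum)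
  also have "\<dots> \<le> real (card I) * b" using assms(3) by (rule sum_bounded_above)
  finally show ?thesis .
qed

text \<open>Each step of a walk either revisits one of the at most \<open>t\<close> vertices seen so far or, at most
  \<open>t - card T\<close> times, moves to one of at most \<open>D\<close> new ones.\<close>

lemma card_walks_small_support:
  assumes S: "finite S" and D: "\<And>v. v \<in> S \<Longrightarrow> real (card {u \<in> S. E v u}) \<le> D" "1 \<le> D"
  shows "finite T \<Longrightarrow> card T \<le> t \<Longrightarrow>
    real (card {xs. length xs = k \<and> (\<exists>w. walk E S v xs w) \<and> card (T \<union> set xs) \<le> t})
      \<le> (real t + 1) ^ k * D ^ (t - card T)"
proof (induction k arbitrary: v T)
  case 0
  have "card {xs. length xs = 0 \<and> (\<exists>w. walk E S v xs w) \<and> card (T \<union> set xs) \<le> t} \<le> card {[] :: 'a list}"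
    by (intro card_mono) auto
  then show ?case using one_le_power[OF D(2), of "t - card T"] by simp
next
  case (Suc k)
  define A where "A k v T = {xs. length xs = k \<and> (\<exists>w. walk E S v xs w) \<and> card (T \<union> set xs) \<le> t}" for k v T
  have finA: "finite (A k v T)" for k v T
  proof (rule finite_subset)
    show "A k v T \<subseteq> {xs. set xs \<subseteq> S \<and> length xs = k}"
      by (auto simp: A_def dest: walk_set)
  qed (rule finite_lists_length_eq[OF S])
  show ?case
  proof (cases "v \<in> S")
    case False
    then have "A (Suc k) v T = {}" by (auto simp: A_def dest: walk_start)
    then show ?thesis using D(2) by (simp only: A_def card.empty of_nat_0) simp
  next
    case v: True
    define N where "N = {x \<in> S. E v x}"
    have finN: "finite N" using S by (simp add: N_def)
    define b where "b = (real t + 1) ^ k * D ^ (t - card T)"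
    have b0: "0 \<le> b" using D(2) by (simp add: b_def)
    have IH: "real (card (A k x T')) \<le> (real t + 1) ^ k * D ^ (t - card T')"
      if "finite T'" "card T' \<le> t" for x T'
      unfolding A_def by (rule Suc.IH[OF that])
    \<comment> \<open>The first step revisits a seen vertex or finds a new one. A new one uses up a
      factor \<open>D\<close>, which pays for the choice among at most \<open>D\<close> of them;
      hence \<open>t * b + b\<close> in total.\<close>
    let ?B = "\<Union>x\<in>N \<inter> T. (#) x ` A k x T" and ?C = "\<Union>x\<in>N - T. (#) x ` A k x (insert x T)"
    have "real (card ?B) \<le> real (card (N \<inter> T)) * b"
      using finN Suc.prems by (intro card_UN_image_le finA) (auto simp: b_def intro: IH)
    also have "card (N \<inter> T) \<le> t"
      using Suc.prems card_mono[of T "N \<inter> T"] by auto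
    finally have B: "real (card ?B) \<le> real t * b" using b0 by (simp add: mult_right_mono)
    have C: "real (card ?C) \<le> b"
    proof (cases "card T < t")
      case True
      have "real (card ?C) \<le> real (card (N - T)) * ((real t + 1) ^ k * D ^ (t - Suc (card T)))"
        using finN Suc.prems True
        by (intro card_UN_image_le finA order.trans[OF IH]) auto
      also have "\<dots> \<le> D * ((real t + 1) ^ k * D ^ (t - Suc (card T)))"
      proof (rule mult_right_mono)
        have "card (N - T) \<le> card N" using finN by (intro card_mono) auto
        then show "real (card (N - T)) \<le> D" using D(1)[OF v] by (simp add: N_def)
      qed (use D(2) in simp)
      also have "\<dots> = b" using True by (simp add: b_def Suc_diff_Suc[symmetric])
      finally show ?thesis .
    next
      case False
      \<comment> \<open>No room is left: a further vertex would push the support beyond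
        \<open>t\<close>.\<close>
      then have T: "card T = t" using Suc.prems by linarith
      have "A k x (insert x T) = {}" if "x \<notin> T" for x
      proof -
        have "Suc t = card (insert x T)" using T that Suc.prems by simp
        also have "\<dots> \<le> card (insert x T \<union> set xs)" for xs
          using Suc.prems by (intro card_mono) auto
        finally show ?thesis by (auto simp: A_def Suc_le_eq not_le[symmetric])
      qed
      then have "?C = {}" by auto
      with b0 show ?thesis by (simp only: card.empty of_nat_0)
    qed
    have "A (Suc k) v T \<subseteq> ?B \<union> ?C"
      by (auto simp: A_def length_Suc_conv N_def insert_absorb image_iff dest: walk_start)
    then have "card (A (Suc k) v T) \<le> card ?B + card ?C"
      using finN finA by (intro order.trans[OF card_mono card_Un_le]) auto
    then have "real (card (A (Suc k) v T)) \<le> real t * b + b" using B C by linarith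
    then show ?thesis by (simp add: A_def b_def algebra_simps)
  qed
qed


text \<open>In effect the expectation over a random set containing each vertex independently with
  probability \<open>p\<close>, derandomised one vertex at a time.\<close>

lemma random_deletion:
  assumes V: "finite V" and p: "0 \<le> p" "p \<le> 1" and c: "0 \<le> (c::real)"
  shows "finite I \<Longrightarrow> \<exists>X\<subseteq>V. real (card X) + c * real (card {i \<in> I. Sp i \<inter> X = {}})
    \<le> p * real (card V) + c * (\<Sum>i\<in>I. (1 - p) ^ card (Sp i \<inter> V))"
  using V
proof (induction V arbitrary: I)
  case empty
  then show ?case by auto
next
  case (insert v V)
  let ?w = "\<lambda>i. (1 - p) ^ card (Sp i \<inter> V)"
  define I' where "I' = {i \<in> I. v \<notin> Sp i}"
  define s s' where "s = (\<Sum>i\<in>I - I'. ?w i)" and "s' = (\<Sum>i\<in>I'. ?w i)"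
  have I: "finite I'" "I' \<subseteq> I" using insert.prems by (auto simp: I'_def)
  have sI: "(\<Sum>i\<in>I. ?w i) = s + s'" using I insert.prems by (simp add: s_def s'_def sum.subset_diff)
  have w: "(1 - p) ^ card (Sp i \<inter> insert v V) = (if i \<in> I' then ?w i else (1 - p) * ?w i)" if "i \<in> I" for i
    using that insert.hyps by (auto simp: I'_def)
  have "(\<Sum>i\<in>I. (1 - p) ^ card (Sp i \<inter> insert v V)) =
      (\<Sum>i\<in>I - I'. (1 - p) ^ card (Sp i \<inter> insert v V)) + (\<Sum>i\<in>I'. (1 - p) ^ card (Sp i \<inter> insert v V))"
    using I insert.prems by (simp add: sum.subset_diff)
  also have "(\<Sum>i\<in>I - I'. (1 - p) ^ card (Sp i \<inter> insert v V)) = (1 - p) * s"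
    unfolding s_def sum_distrib_left by (intro sum.cong refl) (use w in auto)
  also have "(\<Sum>i\<in>I'. (1 - p) ^ card (Sp i \<inter> insert v V)) = s'"
    unfolding s'_def by (intro sum.cong refl) (use w I in auto)
  finally have eq: "(\<Sum>i\<in>I. (1 - p) ^ card (Sp i \<inter> insert v V)) = (1 - p) * s + s'" .
  \<comment> \<open>Conditioning on \<open>v\<close>: the bound is the average, with weights
    \<open>p\<close> and \<open>1 - p\<close>, of the bounds with \<open>v\<close> put into the set
    and with \<open>v\<close> kept out. The smaller of the two is at most the average.\<close>
  have rhs: "p * real (card (insert v V)) + c * (\<Sum>i\<in>I. (1 - p) ^ card (Sp i \<inter> insert v V))
      = p * (1 + (p * real (card V) + c * s')) + (1 - p) * (p * real (card V) + c * (s + s'))"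
    using insert.hyps by (simp add: eq) (simp add: algebra_simps)
  obtain X1 where X1: "X1 \<subseteq> V" "real (card X1) + c * real (card {i \<in> I'. Sp i \<inter> X1 = {}}) \<le> p * real (card V) + c * s'"
    using insert.IH[OF I(1)] by (auto simp: s'_def)
  obtain X2 where X2: "X2 \<subseteq> V" "real (card X2) + c * real (card {i \<in> I. Sp i \<inter> X2 = {}}) \<le> p * real (card V) + c * (s + s')"
    using insert.IH[OF insert.prems] unfolding sI by auto
  have "finite X1" "v \<notin> X1" using X1 insert.hyps finite_subset by auto
  moreover have "{i \<in> I. Sp i \<inter> insert v X1 = {}} = {i \<in> I'. Sp i \<inter> X1 = {}}" by (auto simp: I'_def)
  ultimately have X1': "real (card (insert v X1)) + c * real (card {i \<in> I. Sp i \<inter> insert v X1 = {}})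
      \<le> 1 + (p * real (card V) + c * s')"
    using X1(2) by simp
  let ?a = "1 + (p * real (card V) + c * s')" and ?b = "p * real (card V) + c * (s + s')"
  show ?case
  proof (cases "?a \<le> ?b")
    case True
    have "?a = p * ?a + (1 - p) * ?a" by (simp add: algebra_simps)
    also have "\<dots> \<le> p * ?a + (1 - p) * ?b" using True p by (intro add_left_mono mult_left_mono) auto
    finally show ?thesis unfolding rhs using X1' X1(1) by (intro exI[of _ "insert v X1"]) auto
  next
    case False
    have "?b = p * ?b + (1 - p) * ?b" by (simp add: algebra_simps)
    also have "\<dots> \<le> p * ?a + (1 - p) * ?b" using False p by (intro add_right_mono mult_left_mono) auto
    finally show ?thesis unfolding rhs using X2 by (intro exI[of _ X2]) auto
  qed
qed

subsection \<open>Local spectral radius\<close>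

definition steps :: "('a \<Rightarrow> 'a \<Rightarrow> bool) \<Rightarrow> 'a set \<Rightarrow> 'a rel" where
  "steps E V = {(u, v). u \<in> V \<and> v \<in> V \<and> E u v}"

definition graph_ball :: "('a \<Rightarrow> 'a \<Rightarrow> bool) \<Rightarrow> 'a set \<Rightarrow> nat \<Rightarrow> 'a \<Rightarrow> 'a set" where
  "graph_ball E V r v = {w \<in> V. \<exists>k\<le>r. (v, w) \<in> steps E V ^^ k}"

text \<open>For \<open>0 \<le> l\<close> and \<open>B\<close> inside a finite \<open>V\<close> this
  says that the subgraph induced on \<open>B\<close> has largest eigenvalue at most
  \<open>l\<close>. The Rayleigh form lets test functions on different sets be combined.\<close>

definition quad_form_bounded :: "('a \<Rightarrow> 'a \<Rightarrow> bool) \<Rightarrow> 'a set \<Rightarrow> 'a set \<Rightarrow> real \<Rightarrow> bool" where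
  "quad_form_bounded E V B l \<longleftrightarrow> (\<forall>f. inner_on V f (restr_op B (adj E) f) \<le> l * inner_on V f f)"

lemma graph_ball_subset: "graph_ball E V r v \<subseteq> V"
  by (auto simp: graph_ball_def)

lemma card_relpow_image_le:
  assumes V: "finite V" and d: "\<And>v. v \<in> V \<Longrightarrow> card {u \<in> V. E v u} \<le> d" and v: "v \<in> V"
  shows "finite {w. (v, w) \<in> steps E V ^^ k} \<and> card {w. (v, w) \<in> steps E V ^^ k} \<le> d ^ k"
proof (induction k)
  case 0
  have "{w. (v, w) \<in> steps E V ^^ 0} = {v}" by auto
  then show ?case by simp
next
  case (Suc k)
  let ?N = "{w. (v, w) \<in> steps E V ^^ k}"
  have sub: "?N \<subseteq> V" using v by (cases k) (auto simp: steps_def)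
  have eq: "{w. (v, w) \<in> steps E V ^^ Suc k} = (\<Union>x\<in>?N. {u \<in> V. E x u})"
    using sub by (auto simp: steps_def)
  have "card (\<Union>x\<in>?N. {u \<in> V. E x u}) \<le> (\<Sum>x\<in>?N. card {u \<in> V. E x u})"
    using Suc by (intro card_UN_le) auto
  also have "\<dots> \<le> card ?N * d"
    using d sub sum_bounded_above[of ?N "\<lambda>x. card {u \<in> V. E x u}" d] by auto
  also have "\<dots> \<le> d ^ k * d" using Suc by (intro mult_right_mono) auto
  finally show ?case unfolding eq using Suc V by (auto simp: mult.commute)
qed

text \<open>One extra factor \<open>d\<close> absorbs the whole sum; this is how radius
  \<open>2 * r + 1\<close> leads to the exponent \<open>2 * r + 2\<close>.\<close>

lemma geometric_sum_le_power:
  assumes "2 \<le> (d::nat)"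
  shows "(\<Sum>k\<le>s. d ^ k) \<le> d ^ Suc s"
proof -
  have "(\<Sum>k\<le>s. d ^ k) + 1 \<le> d ^ Suc s"
  proof (induction s)
    case (Suc s)
    have "(\<Sum>k\<le>Suc s. d ^ k) + 1 = (\<Sum>k\<le>s. d ^ k) + 1 + d ^ Suc s" by (simp only: sum.atMost_Suc)
    also have "\<dots> \<le> 2 * d ^ Suc s" using Suc by linarith
    also have "\<dots> \<le> d ^ Suc (Suc s)" unfolding power_Suc[of d "Suc s"] by (rule mult_right_mono[OF assms]) simp
    finally show ?case .
  qed (use assms in auto)
  then show ?thesis by linarith
qed

lemma card_graph_ball_le:
  assumes V: "finite V" and d: "\<And>v. v \<in> V \<Longrightarrow> card {u \<in> V. E v u} \<le> d" "2 \<le> d" and v: "v \<in> V"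
  shows "card (graph_ball E V s v) \<le> d ^ Suc s"
proof -
  let ?N = "\<lambda>k. {w. (v, w) \<in> steps E V ^^ k}"
  note N = card_relpow_image_le[OF V d(1) v]
  have "card (graph_ball E V s v) \<le> card (\<Union>k\<in>{..s}. ?N k)"
    using N by (intro card_mono finite_UN_I) (auto simp: graph_ball_def)
  also have "\<dots> \<le> (\<Sum>k\<le>s. card (?N k))" by (intro card_UN_le) auto
  also have "\<dots> \<le> (\<Sum>k\<le>s. d ^ k)" using N by (intro sum_mono) auto
  also have "\<dots> \<le> d ^ Suc s" by (rule geometric_sum_le_power[OF d(2)])
  finally show ?thesis .
qed

lemma sym_steps_relpow:
  assumes "\<And>u v. E u v \<Longrightarrow> E v u" "(u, v) \<in> steps E V ^^ k"
  shows "(v, u) \<in> steps E V ^^ k"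
  using assms(2)
proof (induction k arbitrary: v)
  case (Suc k)
  then obtain w where "(u, w) \<in> steps E V ^^ k" "(w, v) \<in> steps E V" by auto
  then have "(v, w) \<in> steps E V" "(w, u) \<in> steps E V ^^ k" using assms(1) Suc.IH by (auto simp: steps_def)
  then show ?case by (rule relpow_Suc_I2)
qed simp

text \<open>Two balls on which the form exceeds \<open>l\<close> must meet or be joined by an edge, so the centres of
  all such balls lie within distance \<open>2 * r + 1\<close> of each other.\<close>

lemma card_unbounded_balls_le:
  assumes V: "finite V" and E: "\<And>u v. E u v \<Longrightarrow> E v u"
    and d: "\<And>v. v \<in> V \<Longrightarrow> card {u \<in> V. E v u} \<le> d" "2 \<le> d"
    and sep: "\<And>F G. F \<subseteq> V \<Longrightarrow> G \<subseteq> V \<Longrightarrow> F \<inter> G = {} \<Longrightarrow> (\<forall>u\<in>F. \<forall>v\<in>G. \<not> E u v) \<Longrightarrow>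
      quad_form_bounded E V F l \<or> quad_form_bounded E V G l"
  shows "card {v \<in> V. \<not> quad_form_bounded E V (graph_ball E V r v) l} \<le> d ^ (2 * r + 2)"
    (is "card ?U \<le> _")
proof (cases "?U = {}")
  case True
  then show ?thesis by (simp only: card.empty)
next
  case False
  then obtain u where u: "u \<in> ?U" by auto
  have "v \<in> graph_ball E V (2 * r + 1) u" if v: "v \<in> ?U" for v
  proof -
    let ?F = "graph_ball E V r u" and ?G = "graph_ball E V r v"
    have "\<not> (?F \<inter> ?G = {} \<and> (\<forall>x\<in>?F. \<forall>y\<in>?G. \<not> E x y))"
      using sep[of ?F ?G] u v graph_ball_subset[of E V r] by auto
    then consider x where "x \<in> ?F" "x \<in> ?G" | x y where "x \<in> ?F" "y \<in> ?G" "E x y" by auto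
    then show ?thesis
    proof cases
      case 1
      then obtain i j where i: "i \<le> r" "(u, x) \<in> steps E V ^^ i" and j: "j \<le> r" "(v, x) \<in> steps E V ^^ j"
        by (auto simp: graph_ball_def)
      have "(u, v) \<in> steps E V ^^ (i + j)"
        using i(2) sym_steps_relpow[OF E j(2)] by (auto simp: relpow_add)
      then show ?thesis using i j v by (auto simp: graph_ball_def intro!: exI[of _ "i + j"])
    next
      case 2
      then obtain i j where i: "i \<le> r" "(u, x) \<in> steps E V ^^ i" and j: "j \<le> r" "(v, y) \<in> steps E V ^^ j"
        by (auto simp: graph_ball_def)
      have "(x, y) \<in> steps E V" using 2 by (auto simp: graph_ball_def steps_def)
      then have "(u, y) \<in> steps E V ^^ Suc i" using i by auto
      then have "(u, v) \<in> steps E V ^^ (Suc i + j)"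
        using sym_steps_relpow[OF E j(2)] unfolding relpow_add by (rule relcompI)
      then show ?thesis using i j v by (auto simp: graph_ball_def intro!: exI[of _ "Suc i + j"])
    qed
  qed
  then have "?U \<subseteq> graph_ball E V (2 * r + 1) u" by blast
  then have "card ?U \<le> card (graph_ball E V (2 * r + 1) u)"
    using finite_subset[OF graph_ball_subset V] by (rule card_mono[rotated])
  also have "\<dots> \<le> d ^ (2 * r + 2)" using card_graph_ball_le[OF V d, where v = u and s = "2 * r + 1"] u by simp
  finally show ?thesis .
qed

section \<open>Walks of bounded length confined to a ball\<close>

lemma restr_op_power_nonneg:
  "0 \<le> (restr_op S (adj E) ^^ k) (point_mass v) w"
proof (induction k arbitrary: w)
  case (Suc k)
  have "restr_op S (adj E) g w \<ge> 0" if "\<And>u. g u \<ge> 0" for g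
    using that by (auto simp: restr_op_def mat_op_def adj_def intro!: sum_nonneg)
  then show ?case using Suc.IH by simp
qed (simp add: point_mass_def)

lemma restr_op_power_support:
  assumes E: "\<And>u v. E u v \<Longrightarrow> E v u" and S: "S \<subseteq> V"
  shows "(restr_op S (adj E) ^^ k) (point_mass v) w \<noteq> 0 \<Longrightarrow> (v, w) \<in> steps E V ^^ k"
proof (induction k arbitrary: w)
  case (Suc k)
  let ?f = "(restr_op S (adj E) ^^ k) (point_mass v)"
  have "restr_op S (adj E) ?f w \<noteq> 0" using Suc.prems by simp
  then have w: "w \<in> S" and "(\<Sum>u\<in>S. adj E w u * ?f u) \<noteq> 0"
    by (auto simp: restr_op_def[of S _ _ w] mat_op_def split: if_splits)
  then obtain u where u: "u \<in> S" "adj E w u * ?f u \<noteq> 0" by (metis (mono_tags, lifting) sum.neutral)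
  then have "E w u" "?f u \<noteq> 0" by (auto simp: adj_def split: if_splits)
  then have "(u, w) \<in> steps E V" "(v, u) \<in> steps E V ^^ k" using E S w u Suc.IH by (auto simp: steps_def)
  then show ?case by auto
qed (auto simp: point_mass_def split: if_splits)

text \<open>A walk of at most \<open>r\<close> steps from \<open>v\<close> stays in the ball and all
  terms are nonnegative, so replacing \<open>S\<close> by the ball can only raise the
  counts.\<close>

lemma restr_op_power_le_ball:
  assumes E: "\<And>u v. E u v \<Longrightarrow> E v u" and V: "finite V" "S \<subseteq> V" "v \<in> V"
  shows "k \<le> r \<Longrightarrow> (restr_op S (adj E) ^^ k) (point_mass v) w
    \<le> (restr_op (graph_ball E V r v) (adj E) ^^ k) (point_mass v) w"
proof (induction k arbitrary: w)
  case (Suc k)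
  let ?B = "graph_ball E V r v"
  let ?f = "(restr_op S (adj E) ^^ k) (point_mass v)" and ?g = "(restr_op ?B (adj E) ^^ k) (point_mass v)"
  show ?case
  proof (cases "(restr_op S (adj E) ^^ Suc k) (point_mass v) w = 0")
    case True
    then show ?thesis using restr_op_power_nonneg[of "Suc k" ?B E v w] by simp
  next
    case False
    then have nz: "restr_op S (adj E) ?f w \<noteq> 0" by simp
    then have w: "w \<in> S" by (auto simp: restr_op_def[of S _ _ w] split: if_splits)
    have wB: "w \<in> ?B"
      using restr_op_power_support[OF E V(2) False] Suc.prems w V(2) unfolding graph_ball_def by blast
    have fB: "u \<in> ?B" if "u \<in> S" "?f u \<noteq> 0" for u
      using restr_op_power_support[OF E V(2) that(2)] Suc.prems that V(2)
      by (auto simp: graph_ball_def intro!: exI[of _ k])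
    have "(\<Sum>u\<in>S. adj E w u * ?f u) = (\<Sum>u\<in>S \<inter> ?B. adj E w u * ?f u)"
      using fB V by (intro sum.mono_neutral_right) (auto intro: finite_subset)
    also have "\<dots> \<le> (\<Sum>u\<in>S \<inter> ?B. adj E w u * ?g u)"
      using Suc by (intro sum_mono mult_left_mono) (auto simp: adj_nonneg)
    also have "\<dots> \<le> (\<Sum>u\<in>?B. adj E w u * ?g u)"
      using V graph_ball_subset[of E V r v] restr_op_power_nonneg[of k ?B E v]
      by (intro sum_mono2) (auto simp: adj_nonneg intro: finite_subset)
    finally show ?thesis using w wB by (simp add: restr_op_def[of _ _ _ w] mat_op_def)
  qed
qed simp

text \<open>A closed walk of \<open>2 * k\<close> steps consists of two halves of \<open>k\<close>
  steps, so a ball of half its length controls it.\<close>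

lemma local_norm_bound:
  assumes E: "\<And>u v. E u v \<Longrightarrow> E v u" and V: "finite V" "S \<subseteq> V" "v \<in> V" and l: "0 < l"
    and bounded: "quad_form_bounded E V (graph_ball E V r v) l" and k: "k \<le> r"
  shows "inner_on V ((restr_op S (adj E) ^^ k) (point_mass v)) ((restr_op S (adj E) ^^ k) (point_mass v))
    \<le> l ^ (2 * k)"
proof -
  let ?B = "graph_ball E V r v"
  let ?f = "(restr_op S (adj E) ^^ k) (point_mass v)" and ?g = "(restr_op ?B (adj E) ^^ k) (point_mass v)"
  have sym: "adj E u w = adj E w u" for u w using E by (auto simp: adj_def)
  have "inner_on V ?f ?f \<le> inner_on V ?g ?g"
    unfolding inner_on_def
    by (intro sum_mono mult_mono restr_op_power_le_ball[OF E V k] restr_op_power_nonneg)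
  also have "\<dots> \<le> l ^ (2 * k) * inner_on V (point_mass v) (point_mass v)"
  proof (rule restr_op_power_norm_bound)
    fix f show "inner_on V (restr_op ?B (adj E) f) (restr_op ?B (adj E) f) \<le> l\<^sup>2 * inner_on V f f"
      using bounded by (intro restr_op_norm_bound V(1) graph_ball_subset sym l)
        (auto simp: adj_def quad_form_bounded_def)
  qed
  finally show ?thesis using V by (simp add: inner_on_point_mass) (simp add: point_mass_def)
qed

text \<open>The degree is the squared norm of the operator at a point mass, that is the local bound
  for a single step. It lets powers of \<open>l\<close> take the place of the maximum degree when
  walks of small support are counted.\<close>

lemma local_degree_bound:
  assumes E: "\<And>u v. E u v \<Longrightarrow> E v u" and V: "finite V" "v \<in> V" and l: "0 < l"
    and bounded: "quad_form_bounded E V (graph_ball E V r v) l" and r: "1 \<le> r"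
  shows "real (card {u \<in> V. E v u}) \<le> l\<^sup>2"
proof -
  have eq: "restr_op V (adj E) (point_mass v) w = (if w \<in> V \<and> E v w then 1 else 0)" for w
  proof -
    have "mat_op V (adj E) (point_mass v) w = inner_on V (adj E w) (point_mass v)"
      by (simp add: mat_op_def inner_on_def)
    also have "\<dots> = adj E w v" using V by (simp add: inner_on_point_mass)
    finally show ?thesis using E by (auto simp: restr_op_def adj_def)
  qed
  have "real (card {u \<in> V. E v u}) = (\<Sum>w\<in>V. if E v w then 1 else 0)"
    using V by (simp add: sum.If_cases Int_def)
  also have "\<dots> = inner_on V (restr_op V (adj E) (point_mass v)) (restr_op V (adj E) (point_mass v))"
    unfolding inner_on_def eq by (intro sum.cong) auto
  also have "\<dots> \<le> l\<^sup>2"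
    using local_norm_bound[OF E V(1) order.refl V(2) l bounded r] by simp
  finally show ?thesis .
qed

text \<open>The four terms stand for the exceptional vertices, the random set, and the surviving
  walks of large and of small support; the last two are divided by \<open>l ^ (2 * r)\<close>, the
  share of one eigenfunction in the trace.\<close>

lemma multiplicity_bound:
  assumes V: "finite V" and E: "\<And>u v. E u v \<Longrightarrow> E v u"
    and d: "\<And>v. v \<in> V \<Longrightarrow> card {u \<in> V. E v u} \<le> d" "2 \<le> d"
    and sep: "\<And>F G. F \<subseteq> V \<Longrightarrow> G \<subseteq> V \<Longrightarrow> F \<inter> G = {} \<Longrightarrow> (\<forall>u\<in>F. \<forall>v\<in>G. \<not> E u v) \<Longrightarrow>
      quad_form_bounded E V F l \<or> quad_form_bounded E V G l"
    and J: "finite J" and on: "orthonormal_on V J x"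
    and ev: "\<And>j v. j \<in> J \<Longrightarrow> v \<in> V \<Longrightarrow> mat_op V (adj E) (x j) v = l * x j v"
    and l: "1 \<le> l" and r: "1 \<le> r" and p: "0 \<le> p" "p \<le> 1" and t: "1 \<le> t"
  shows "real (card J) \<le> real d ^ (2 * r + 2) + p * real (card V)
    + real (card V) * ((1 - p) ^ t + (real t + 1) ^ (2 * r) * (l\<^sup>2) ^ t / l ^ (2 * r))"
proof -
  define U where "U = {v \<in> V. \<not> quad_form_bounded E V (graph_ball E V r v) l}"
  define H where "H = V - U"
  have "card U \<le> d ^ (2 * r + 2)"
    unfolding U_def by (rule card_unbounded_balls_le[OF V E d sep])
  then have cardU: "real (card U) \<le> real d ^ (2 * r + 2)"
    unfolding of_nat_power[symmetric] by (rule of_nat_mono)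
  have H: "H \<subseteq> V" "finite H" using V by (auto simp: H_def)
  have good: "quad_form_bounded E V (graph_ball E V r v) l" if "v \<in> H" for v
    using that by (auto simp: H_def U_def)
  have l0: "0 < l" using l by simp
  have sym: "adj E u v = adj E v u" for u v using E by (auto simp: adj_def)
  define n where "n = real (card V)"
  have cardH: "real (card H) \<le> n" using H V by (auto simp: n_def intro: card_mono)
  define cw where "cw S v = {xs. length xs = 2 * r \<and> walk E S v xs v}" for S v
  define I where "I = Sigma H (cw H)"
  define Sp where "Sp i = insert (fst i) (set (snd i))" for i :: "'a \<times> 'a list"
  have fincw: "finite (cw S v)" if "finite S" for S v using finite_walks[OF that] by (simp add: cw_def)
  have finI: "finite I" unfolding I_def using H fincw by (intro finite_SigmaI) auto
  have SpH: "Sp i \<subseteq> H" if "i \<in> I" for i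
    using that by (auto simp: I_def cw_def Sp_def dest: walk_set)
  have cardcw: "real (card (cw S v)) = (restr_op S (adj E) ^^ (2 * r)) (point_mass v) v"
    if "v \<in> S" "finite S" for S v
    unfolding cw_def by (rule card_walks[OF that(2,1)])
  have "real (card (cw H v)) \<le> l ^ (2 * r)" if "v \<in> H" for v
    using local_norm_bound[OF E V H(1) _ l0 good[OF that] order.refl] that H
    by (subst cardcw) (auto simp: restr_op_even_power_diagonal[OF V H(1) sym])
  then have "real (card I) \<le> real (card H) * l ^ (2 * r)"
    unfolding I_def using H fincw sum_bounded_above[of H "\<lambda>v. real (card (cw H v))" "l ^ (2 * r)"]
    by (simp add: card_SigmaI)
  also have "\<dots> \<le> n * l ^ (2 * r)" using cardH l by (intro mult_right_mono) auto
  finally have cardI: "real (card I) \<le> n * l ^ (2 * r)" .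
  define I0 where "I0 = {i \<in> I. card (Sp i) \<le> t}"
  define A where "A v = {xs. length xs = 2 * r \<and> (\<exists>w. walk E H v xs w) \<and> card ({v} \<union> set xs) \<le> t}" for v
  have finA: "finite (A v)" for v
  proof (rule finite_subset)
    show "A v \<subseteq> {xs. set xs \<subseteq> H \<and> length xs = 2 * r}"
      by (auto simp: A_def dest: walk_set)
  qed (rule finite_lists_length_eq[OF H(2)])
  have degH: "real (card {u \<in> H. E v u}) \<le> l\<^sup>2" if "v \<in> H" for v
  proof -
    have "card {u \<in> H. E v u} \<le> card {u \<in> V. E v u}" using H V by (intro card_mono) auto
    then show ?thesis using local_degree_bound[OF E V _ l0 good[OF that] r] that H by force
  qed
  have cardA: "real (card (A v)) \<le> (real t + 1) ^ (2 * r) * (l\<^sup>2) ^ t" for v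
  proof -
    \<comment> \<open>The base point counts as already seen, whence the exponent
      \<open>t - 1\<close>; it is rounded up using \<open>1 \<le> l\<close>.\<close>
    have "real (card (A v)) \<le> (real t + 1) ^ (2 * r) * (l\<^sup>2) ^ (t - card {v})"
      unfolding A_def using t l by (intro card_walks_small_support H degH) (auto simp: one_le_power)
    also have "\<dots> \<le> (real t + 1) ^ (2 * r) * (l\<^sup>2) ^ t"
      using l by (intro mult_left_mono power_increasing) (auto simp: one_le_power)
    finally show ?thesis .
  qed
  have "I0 \<subseteq> Sigma H A" by (auto simp: I0_def I_def cw_def A_def Sp_def)
  then have "card I0 \<le> (\<Sum>v\<in>H. card (A v))"
    using H finA card_mono[of "Sigma H A" I0] by (simp add: card_SigmaI finite_SigmaI)
  then have "real (card I0) \<le> (\<Sum>v\<in>H. real (card (A v)))" by (simp flip: of_nat_sum)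
  also have "\<dots> \<le> real (card H) * ((real t + 1) ^ (2 * r) * (l\<^sup>2) ^ t)"
    using cardA by (intro sum_bounded_above) auto
  also have "\<dots> \<le> n * ((real t + 1) ^ (2 * r) * (l\<^sup>2) ^ t)"
    using cardH by (intro mult_right_mono) auto
  finally have cardI0: "real (card I0) \<le> n * ((real t + 1) ^ (2 * r) * (l\<^sup>2) ^ t)" .
  \<comment> \<open>Walks of small support get the trivial survival probability 1, all others at
    most \<open>(1 - p) ^ t\<close>.\<close>
  have "(\<Sum>i\<in>I. (1 - p) ^ card (Sp i \<inter> V)) \<le> (\<Sum>i\<in>I. (if i \<in> I0 then 1 else 0) + (1 - p) ^ t)"
  proof (intro sum_mono)
    fix i assume i: "i \<in> I"
    then have eq: "Sp i \<inter> V = Sp i" using SpH[OF i] H by blast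
    show "(1 - p) ^ card (Sp i \<inter> V) \<le> (if i \<in> I0 then 1 else 0) + (1 - p) ^ t"
    proof (cases "i \<in> I0")
      case True
      have "(1 - p) ^ card (Sp i) \<le> 1" "0 \<le> (1 - p) ^ t" using p by (auto intro: power_le_one)
      then show ?thesis using True by (simp add: eq)
    next
      case False
      then have "t \<le> card (Sp i)" using i by (auto simp: I0_def)
      then have "(1 - p) ^ card (Sp i) \<le> (1 - p) ^ t" using p by (intro power_decreasing) auto
      then show ?thesis using False by (simp add: eq)
    qed
  qed
  also have "\<dots> = real (card I0) + real (card I) * (1 - p) ^ t"
    using finI by (simp add: sum.distrib sum.If_cases Int_def I0_def)
  also have "\<dots> \<le> n * ((real t + 1) ^ (2 * r) * (l\<^sup>2) ^ t) + (n * l ^ (2 * r)) * (1 - p) ^ t"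
    using cardI cardI0 p by (intro add_mono mult_right_mono) auto
  finally have total: "(\<Sum>i\<in>I. (1 - p) ^ card (Sp i \<inter> V)) \<le>
    n * ((real t + 1) ^ (2 * r) * (l\<^sup>2) ^ t) + (n * l ^ (2 * r)) * (1 - p) ^ t" .
  \<comment> \<open>The weight prices a surviving walk in units of one eigenfunction, the same unit
    in which a deleted vertex costs 1.\<close>
  obtain X where X: "X \<subseteq> V" "real (card X) + (1 / l ^ (2 * r)) * real (card {i \<in> I. Sp i \<inter> X = {}})
      \<le> p * n + (1 / l ^ (2 * r)) * (\<Sum>i\<in>I. (1 - p) ^ card (Sp i \<inter> V))"
    using random_deletion[OF V p _ finI, of "1 / l ^ (2 * r)" Sp] l0 by (auto simp: n_def)
  define W where "W = U \<union> X"
  have W: "W \<subseteq> V" using X by (auto simp: W_def U_def)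
  have VW: "V - W = H - X" by (auto simp: W_def H_def)
  have "(real (card J) - real (card W)) * l ^ (2 * r)
      \<le> (\<Sum>v\<in>V - W. (restr_op (V - W) (adj E) ^^ (2 * r)) (point_mass v) v)"
    by (rule eigenfunctions_card_le_trace[OF V W J sym on ev])
  also have "\<dots> = (\<Sum>v\<in>H - X. real (card (cw (H - X) v)))"
    unfolding VW using H by (intro sum.cong) (auto simp: cardcw)
  also have "\<dots> = real (card (Sigma (H - X) (cw (H - X))))"
    using H fincw[of "H - X"] by (simp add: card_SigmaI)
  also have "Sigma (H - X) (cw (H - X)) = {i \<in> I. Sp i \<inter> X = {}}"
    using walk_subset_iff[of "H - X" H E]
    by (auto simp: I_def cw_def Sp_def dest: walk_set)
  finally have "real (card J) - real (card W) \<le> (1 / l ^ (2 * r)) * real (card {i \<in> I. Sp i \<inter> X = {}})"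
    using l0 by (simp add: field_simps)
  moreover have "card W \<le> card U + card X" unfolding W_def by (rule card_Un_le)
  moreover have "(1 / l ^ (2 * r)) * (\<Sum>i\<in>I. (1 - p) ^ card (Sp i \<inter> V)) \<le>
      n * ((1 - p) ^ t + (real t + 1) ^ (2 * r) * (l\<^sup>2) ^ t / l ^ (2 * r))"
  proof -
    have "(1 / l ^ (2 * r)) * (\<Sum>i\<in>I. (1 - p) ^ card (Sp i \<inter> V)) \<le>
      (1 / l ^ (2 * r)) * (n * ((real t + 1) ^ (2 * r) * (l\<^sup>2) ^ t) + (n * l ^ (2 * r)) * (1 - p) ^ t)"
      using l0 by (intro mult_left_mono total) auto
    also have "\<dots> = n * ((1 - p) ^ t + (real t + 1) ^ (2 * r) * (l\<^sup>2) ^ t / l ^ (2 * r))"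
      using l0 by (simp add: field_simps)
    finally show ?thesis .
  qed
  ultimately show ?thesis using cardU X(2) unfolding n_def by linarith
qed

subsection \<open>The choice of parameters and the conclusion\<close>

text \<open>By concavity the logarithm lies above its chord between 1 and 17, whose slope is at
  least \<open>4 / 16\<close>. For an eigenvalue below 16 this makes the bound in (ii)
  trivial.\<close>

lemma log_add_one_ge:
  assumes "0 \<le> x" "x \<le> 16"
  shows "x / 4 \<le> log 2 (x + 1)"
proof -
  have c: "concave_on {0<..} (log 2)" by (rule log_concave) simp
  have "(4::real) = log 2 (2 ^ 4)" by (subst log_pow_cancel) auto
  also have "\<dots> \<le> log 2 17" by (subst log_le_cancel_iff) auto
  finally have "x / 16 * 4 \<le> x / 16 * log 2 17" using assms by (intro mult_left_mono) auto
  also have "\<dots> \<le> log 2 ((1 - x / 16) *\<^sub>R 1 + (x / 16) *\<^sub>R 17)"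
    using concave_onD[OF c, of "x / 16" 1 17] assms by simp
  also have "(1 - x / 16) *\<^sub>R 1 + (x / 16) *\<^sub>R 17 = x + 1" by simp
  finally show ?thesis by simp
qed

text \<open>With \<open>p = 3 * k / M\<close> and \<open>t\<close> at least \<open>M / 4\<close> the
  product \<open>p * t\<close> is at least \<open>3 / 4 * k\<close>; it has to reach
  \<open>k * ln 2\<close> for the survival probability to be at most \<open>1 / M\<close>.\<close>

lemma ln_2_le: "ln 2 \<le> (3 / 4 :: real)"
proof -
  have "2 \<le> 1 + 3 / 4 + (3 / 4)\<^sup>2 / (2::real)" by (simp add: power2_eq_square)
  also have "\<dots> \<le> exp (3 / 4)" by (rule exp_lower_Taylor_quadratic) simp
  finally have "ln 2 \<le> ln (exp (3 / 4 :: real))" by (subst ln_le_cancel_iff) auto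
  then show ?thesis by simp
qed

text \<open>Balls of radius \<open>r \<approx> (L - 2 - log 2 M) / 2\<close>, deletion probability \<open>p = 3 log 2 M / M\<close> and
  support threshold \<open>t \<approx> M / 4\<close>; if \<open>p > 1\<close>, the bound is trivial.\<close>

lemma parameter_choice:
  fixes M L lam \<Delta> n m :: real and d :: nat
  assumes M: "16 \<le> M" "M \<le> lam" "M * log 2 M \<le> L" and d: "2 \<le> d" "real d \<le> \<Delta>"
    and n: "0 < n" and L: "L = log \<Delta> n"
    and bound: "\<And>r t p. 1 \<le> r \<Longrightarrow> 1 \<le> t \<Longrightarrow> 0 \<le> p \<Longrightarrow> p \<le> 1 \<Longrightarrow>
      m \<le> real d ^ (2 * r + 2) + p * n
        + n * ((1 - p) ^ t + (real t + 1) ^ (2 * r) * (lam\<^sup>2) ^ t / lam ^ (2 * r))"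
    and trivial: "m \<le> n"
  shows "m \<le> 4 * n * log 2 M / M"
proof -
  define k where "k = log 2 M"
  have Mk: "M = 2 powr k" using M by (simp add: k_def)
  have "(4::real) = log 2 (2 ^ 4)" by (subst log_pow_cancel) auto
  also have "\<dots> \<le> k" unfolding k_def using M by (subst log_le_cancel_iff) auto
  finally have k: "4 \<le> k" .
  define p where "p = 3 * k / M"
  show ?thesis
  proof (cases "p \<le> 1")
    case False
    then have "M \<le> 4 * k" using M k by (simp add: p_def field_simps)
    then have "n * M \<le> n * (4 * k)" using n by (intro mult_left_mono) auto
    then have "n \<le> 4 * n * k / M" using M by (simp add: field_simps)
    then show ?thesis using trivial unfolding k_def by linarith
  next
    case p1: True
    have p0: "0 \<le> p" using M k by (simp add: p_def)
    \<comment> \<open>The 2 offsets the exponent \<open>2 * r + 2\<close>, and \<open>k\<close>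
      leaves a factor \<open>\<Delta> powr (- k)\<close>, at most \<open>1 / M\<close> because
      \<Delta> is at least 2.\<close>
    define r where "r = nat \<lfloor>(L - 2 - k) / 2\<rfloor>"
    define t where "t = nat \<lceil>M / 4\<rceil>"
    define q where "q = M * k"
    have kM: "q \<le> L" using M by (simp add: k_def q_def)
    have Mk16: "16 * k \<le> q" "M * 4 \<le> q"
      unfolding q_def using M k by (auto intro: mult_right_mono mult_left_mono)
    have "0 \<le> L - 2 - k" using kM Mk16 k by linarith
    then have "real r = of_int \<lfloor>(L - 2 - k) / 2\<rfloor>" by (simp add: r_def)
    then have "real r \<le> (L - 2 - k) / 2" "(L - 2 - k) / 2 < real r + 1"
      using of_int_floor_le[of "(L - 2 - k) / 2"] real_of_int_floor_add_one_gt[of "(L - 2 - k) / 2"]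
      by presburger+
    then have r: "2 * real r \<le> L - 2 - k" "L - 4 - k < 2 * real r" by (simp_all add: field_simps)
    have r1: "1 \<le> r" using r kM Mk16 k by linarith
    have "real t = of_int \<lceil>M / 4\<rceil>" using M by (simp add: t_def)
    then have t: "M / 4 \<le> real t" "real t \<le> M / 4 + 1"
      using le_of_int_ceiling[of "M / 4"] of_int_ceiling_le_add_one[of "M / 4"] by presburger+
    have t1: "1 \<le> t" using t M by linarith
    have tr: "t \<le> r" using t r kM Mk16 k M by linarith
    have "1 < \<Delta>" using d by linarith
    then have n_eq: "\<Delta> powr L = n" using n L by simp
    have "real d ^ (2 * r + 2) \<le> \<Delta> ^ (2 * r + 2)" using d by (intro power_mono) auto
    also have "\<dots> = \<Delta> powr real (2 * r + 2)" using \<open>1 < \<Delta>\<close> by (subst powr_realpow) auto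
    also have "\<dots> \<le> \<Delta> powr (L - k)" using r \<open>1 < \<Delta>\<close> by (intro powr_mono) auto
    also have "\<dots> = n / \<Delta> powr k" by (simp add: powr_diff n_eq)
    also have "\<dots> \<le> n / M"
      unfolding Mk using d n k by (intro divide_left_mono powr_mono2 mult_pos_pos) auto
    finally have U: "real d ^ (2 * r + 2) \<le> n / M" .
    have "(1 - p) ^ t \<le> exp (- p) ^ t" using p1 exp_ge_add_one_self[of "- p"] by (intro power_mono) auto
    also have "\<dots> = exp (- (p * real t))" by (simp add: exp_of_nat_mult[symmetric] mult.commute)
    also have "\<dots> \<le> exp (- (k * ln 2))"
    proof -
      have "k * ln 2 \<le> k * (3 / 4)" using k ln_2_le by (intro mult_left_mono) auto
      also have "\<dots> = p * (M / 4)" using M by (simp add: p_def)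
      also have "\<dots> \<le> p * real t" using p0 t by (intro mult_left_mono) auto
      finally show ?thesis by simp
    qed
    also have "\<dots> = 1 / M" by (simp add: Mk powr_def exp_minus divide_inverse)
    finally have large: "(1 - p) ^ t \<le> 1 / M" .
    have lam: "0 < lam" using M by linarith
    have "(real t + 1) ^ (2 * r) * (lam\<^sup>2) ^ t / lam ^ (2 * r) = (real t + 1) ^ (2 * r) / lam ^ (2 * r - 2 * t)"
      using tr lam by (simp add: power_diff flip: power_mult)
    \<comment> \<open>After cancellation, possible by \<open>t \<le> r\<close>, \<open>lam\<close>
      is left only in the denominator and may be lowered to \<open>M\<close>. As
      \<open>t + 1\<close> is at most \<open>M / 4 + 2\<close>, hence at most \<open>M / 2\<close>,
      each of the \<open>2 * r\<close> steps gains a factor 2.\<close>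
    also have "\<dots> \<le> (M / 2) ^ (2 * r) / M ^ (2 * r - 2 * t)"
      using M t by (intro frac_le power_mono) auto
    also have "\<dots> = M ^ (2 * t) / 2 ^ (2 * r)"
      using tr M by (simp add: power_diff power_divide)
    also have "\<dots> = 2 powr (k * real (2 * t)) / 2 powr real (2 * r)"
      by (simp only: Mk powr_realpow[symmetric] powr_powr powr_gt_zero zero_less_numeral)
    also have "\<dots> = 2 powr (2 * real t * k - 2 * real r)" by (simp add: powr_diff mult_ac)
    also have "\<dots> \<le> 2 powr (- k)"
    proof (intro powr_mono)
      \<comment> \<open>Rounding \<open>t\<close> up turns \<open>M / 2\<close> into at most
        \<open>5 / 8 * M\<close>, as \<open>16 \<le> M\<close>. The remaining
        \<open>3 / 8 * q\<close> covers the \<open>4 + k\<close> lost in the choice of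
        \<open>r\<close> and the target \<open>- k\<close>.\<close>
      have "2 * real t * k \<le> (5 / 8 * M) * k" using t M k by (intro mult_right_mono) auto
      also have "\<dots> = 5 / 8 * q" by (simp add: q_def)
      finally show "2 * real t * k - 2 * real r \<le> - k" using r kM Mk16 k by linarith
    qed auto
    also have "\<dots> = 1 / M" by (simp add: Mk powr_minus divide_inverse)
    finally have small: "(real t + 1) ^ (2 * r) * (lam\<^sup>2) ^ t / lam ^ (2 * r) \<le> 1 / M" .
    \<comment> \<open>Three errors of \<open>n / M\<close> join \<open>p * n\<close>; together they
      stay below \<open>4 * k * n / M\<close> since \<open>k\<close> exceeds 3.\<close>
    have "m \<le> n / M + p * n + n * (1 / M + 1 / M)"
      using bound[OF r1 t1 p0 p1] U large small n
      by (smt (verit) mult_left_mono)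
    also have "\<dots> = n * (3 * k + 3) / M" using M by (simp add: p_def field_simps)
    also have "\<dots> \<le> n * (4 * k) / M" using M k n by (intro divide_right_mono mult_left_mono) auto
    finally show ?thesis by (simp add: k_def mult_ac)
  qed
qed

text \<open>If the form exceeded \<open>l\<close> on functions supported on \<open>F\<close> and on \<open>G\<close>, it would do so on their
  span, which contains a nonzero function orthogonal to \<open>z\<close>.\<close>

lemma separated_sets_quad_form_bounded:
  fixes z :: "'a \<Rightarrow> real"
  assumes V: "finite V" and E: "\<And>u v. E u v \<Longrightarrow> E v u" and l: "0 \<le> l"
    and rayleigh: "\<And>h. inner_on V h z = 0 \<Longrightarrow> inner_on V h (mat_op V (adj E) h) \<le> l * inner_on V h h"
    and FG: "F \<subseteq> V" "G \<subseteq> V" "F \<inter> G = {}" "\<forall>u\<in>F. \<forall>v\<in>G. \<not> E u v"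
  shows "quad_form_bounded E V F l \<or> quad_form_bounded E V G l"
proof (rule ccontr)
  let ?T = "mat_op V (adj E)"
  \<comment> \<open>Truncating a witness to \<open>S\<close> preserves the form and can only lower
    the norm, so by \<open>0 \<le> l\<close> the strict inequality persists.\<close>
  have cut: "\<exists>f'. (\<forall>v. v \<notin> S \<longrightarrow> f' v = 0) \<and> l * inner_on V f' f' < inner_on V f' (?T f')"
    if S: "S \<subseteq> V" "\<not> quad_form_bounded E V S l" for S
  proof -
    obtain f where f: "l * inner_on V f f < inner_on V f (restr_op S (adj E) f)"
      using S(2) by (auto simp: quad_form_bounded_def not_le)
    define f' where "f' v = (if v \<in> S then f v else 0)" for v
    have "inner_on V f' f' \<le> inner_on V f f"
      unfolding inner_on_def by (intro sum_mono) (auto simp: f'_def)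
    then have "l * inner_on V f' f' \<le> l * inner_on V f f" using l by (rule mult_left_mono)
    also note f
    also have "inner_on V f (restr_op S (adj E) f) = inner_on V f' (?T f')"
    proof -
      have "mat_op V (adj E) f' v = mat_op S (adj E) f v" for v
        unfolding mat_op_def using V S by (intro sum.mono_neutral_cong_right) (auto simp: f'_def)
      then show ?thesis
        unfolding inner_on_def by (intro sum.cong) (auto simp: f'_def restr_op_def)
    qed
    finally show ?thesis by (intro exI[of _ f']) (auto simp: f'_def)
  qed
  assume "\<not> ?thesis"
  then have nb: "\<not> quad_form_bounded E V F l" "\<not> quad_form_bounded E V G l" by auto
  obtain f where f: "\<And>v. v \<notin> F \<Longrightarrow> f v = 0" "l * inner_on V f f < inner_on V f (?T f)"
    using cut[OF FG(1) nb(1)] by auto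
  obtain g where g: "\<And>v. v \<notin> G \<Longrightarrow> g v = 0" "l * inner_on V g g < inner_on V g (?T g)"
    using cut[OF FG(2) nb(2)] by auto
  have fg: "inner_on V f g = 0"
    unfolding inner_on_def using f(1) g(1) FG(3) by (intro sum.neutral) auto
  have fTg: "inner_on V f (?T g) = 0"
    unfolding inner_on_def mat_op_def sum_distrib_left
  proof (intro sum.neutral ballI)
    fix v u show "f v * (adj E v u * g u) = 0"
      using f(1)[of v] g(1)[of u] FG(4) by (cases "v \<in> F"; cases "u \<in> G") (auto simp: adj_def)
  qed
  have gTf: "inner_on V g (?T f) = 0"
    using fTg mat_op_symmetric[of V "adj E" g f] E inner_on_commute[of V "?T g" f]
    by (auto simp: adj_def)
  obtain c d :: real where cd: "c \<noteq> 0 \<or> d \<noteq> 0" "c * inner_on V f z + d * inner_on V g z = 0"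
  proof (cases "inner_on V f z = 0")
    case True
    then show ?thesis by (intro that[of 1 0]) auto
  next
    case False
    then show ?thesis by (intro that[of "- inner_on V g z" "inner_on V f z"]) auto
  qed
  define h where "h = (\<lambda>v. c * f v + d * g v)"
  have Th: "?T h = (\<lambda>v. c * ?T f v + d * ?T g v)" by (auto simp: h_def mat_op_add mat_op_scale)
  have "inner_on V h (?T h) = c\<^sup>2 * inner_on V f (?T f) + d\<^sup>2 * inner_on V g (?T g)"
    unfolding Th by (simp add: h_def inner_on_linear fTg gTf power2_eq_square algebra_simps)
  moreover have "inner_on V h h = c\<^sup>2 * inner_on V f f + d\<^sup>2 * inner_on V g g"
    by (simp add: h_def inner_on_linear fg inner_on_commute[of V g f] power2_eq_square algebra_simps)
  moreover have "inner_on V h z = 0" using cd(2) by (simp add: h_def inner_on_linear)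
  ultimately have "c\<^sup>2 * (inner_on V f (?T f) - l * inner_on V f f)
      + d\<^sup>2 * (inner_on V g (?T g) - l * inner_on V g g) \<le> 0"
    using rayleigh[of h] by (simp add: algebra_simps)
  moreover have "0 < c\<^sup>2 * (inner_on V f (?T f) - l * inner_on V f f) \<or> c = 0"
    "0 < d\<^sup>2 * (inner_on V g (?T g) - l * inner_on V g g) \<or> d = 0"
    using f(2) g(2) by auto
  ultimately show False using cd(1) by (cases "c = 0"; cases "d = 0") auto
qed

section \<open>Rayleigh quotients for the second eigenvalue and the passage to the graph\<close>

lemma rayleigh_second_eigenvalue:
  fixes n :: nat
  assumes on: "orthonormal_on {..<n} {..<n} x"
    and ev: "\<And>i v. i < n \<Longrightarrow> v < n \<Longrightarrow> mat_op {..<n} a (x i) v = e i * x i v"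
    and le: "\<And>i. i < n \<Longrightarrow> i \<noteq> i0 \<Longrightarrow> e i \<le> l"
    and h: "inner_on {..<n} h (x i0) = 0"
  shows "inner_on {..<n} h (mat_op {..<n} a h) \<le> l * inner_on {..<n} h h"
proof -
  let ?c = "\<lambda>i. inner_on {..<n} h (x i)"
  have hk: "h k = (\<Sum>i<n. ?c i * x i k)" if "k < n" for k
    using orthonormal_on_expand[OF on that] .
  have hh: "inner_on {..<n} h h = (\<Sum>i<n. ?c i * ?c i)"
  proof -
    have "inner_on {..<n} h h = inner_on {..<n} h (\<lambda>k. \<Sum>i<n. ?c i * x i k)"
      by (rule inner_on_cong) (simp_all add: hk[symmetric])
    then show ?thesis by (simp add: inner_on_linear)
  qed
  have "inner_on {..<n} h (mat_op {..<n} a h) = inner_on {..<n} h (\<lambda>k. \<Sum>i<n. (e i * ?c i) * x i k)"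
  proof (rule inner_on_cong)
    fix k assume k: "k \<in> {..<n}"
    have "mat_op {..<n} a h k = mat_op {..<n} a (\<lambda>k. \<Sum>i<n. ?c i * x i k) k"
      by (rule mat_op_cong) (simp add: hk[symmetric])
    also have "\<dots> = (\<Sum>i<n. (e i * ?c i) * x i k)"
      unfolding mat_op_sum mat_op_scale using ev k by (intro sum.cong refl) simp
    finally show "mat_op {..<n} a h k = (\<Sum>i<n. (e i * ?c i) * x i k)" .
  qed simp
  also have "\<dots> = (\<Sum>i<n. e i * (?c i * ?c i))" by (simp add: inner_on_linear mult.assoc)
  also have "\<dots> \<le> (\<Sum>i<n. l * (?c i * ?c i))"
  proof (intro sum_mono)
    fix i assume "i \<in> {..<n}"
    then show "e i * (?c i * ?c i) \<le> l * (?c i * ?c i)"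
      using le[of i] h by (cases "i = i0") (auto intro: mult_right_mono)
  qed
  also have "\<dots> = l * inner_on {..<n} h h" by (simp add: hh sum_distrib_left)
  finally show ?thesis .
qed

text \<open>A repeated top eigenvalue does not single out an index by its value. Removing one
  occurrence leaves, as a multiset, the sorted list from its second entry on; the removed index
  names the eigenvector to be orthogonal to.\<close>

lemma all_but_one_le_second_largest:
  fixes es :: "real list"
  assumes "2 \<le> length es"
  obtains i0 where "i0 < length es"
    "\<And>i. i < length es \<Longrightarrow> i \<noteq> i0 \<Longrightarrow> es ! i \<le> rev (sort es) ! 1"
proof -
  have "2 \<le> length (rev (sort es))" using assms by simp
  then obtain y0 y1 ys where ys: "rev (sort es) = y0 # y1 # ys"
    by (metis Suc_le_length_iff numeral_2_eq_2)
  have "sorted_wrt (\<ge>) (rev (sort es))" by (simp add: sorted_wrt_rev)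
  then have le: "y \<le> y1" if "y \<in> set (y1 # ys)" for y using that by (auto simp: ys)
  have ms: "mset es = mset (y0 # y1 # ys)" by (metis mset_rev mset_sort ys)
  then have "y0 \<in> set es" by (metis list.set_intros(1) mset_eq_setD)
  then obtain i0 where i0: "i0 < length es" "es ! i0 = y0" by (metis in_set_conv_nth)
  have split: "es = take i0 es @ y0 # drop (Suc i0) es"
    using id_take_nth_drop[OF i0(1)] i0(2) by simp
  have "mset (take i0 es @ drop (Suc i0) es) = mset (y1 # ys)"
    using ms by (subst (asm) split) simp
  then have set_eq: "set (take i0 es @ drop (Suc i0) es) = set (y1 # ys)" by (rule mset_eq_setD)
  have "es ! i \<in> set (take i0 es @ drop (Suc i0) es)" if i: "i < length es" "i \<noteq> i0" for i
  proof (cases "i < i0")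
    case True
    then have "take i0 es ! i = es ! i" "i < length (take i0 es)" using i by auto
    then show ?thesis by (metis UnCI nth_mem set_append)
  next
    case False
    then have "drop (Suc i0) es ! (i - Suc i0) = es ! i" "i - Suc i0 < length (drop (Suc i0) es)"
      using i by auto
    then show ?thesis by (metis UnCI nth_mem set_append)
  qed
  then have "es ! i \<le> rev (sort es) ! 1" if "i < length es" "i \<noteq> i0" for i
    using that le set_eq by (auto simp: ys)
  then show ?thesis using i0(1) that by blast
qed


lemma eigenvalue_multiplicity_le_card:
  "eigenvalue_multiplicity G l \<le> card (verts G)"
proof -
  have A: "adjacency_matrix G \<in> carrier_mat (card (verts G)) (card (verts G))"
    by (simp add: adjacency_matrix_def)
  have "eigenvalue_multiplicity G l \<le> size (graph_spectrum G)"
    unfolding eigenvalue_multiplicity_def by (rule count_le_size)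
  also have "\<dots> \<le> degree (char_poly (adjacency_matrix G))"
    unfolding graph_spectrum_def by (rule size_proots_le)
  also have "\<dots> = card (verts G)" using degree_monic_char_poly[OF A] by simp
  finally show ?thesis .
qed

text \<open>The graph is transported to the positions \<open>{..<n}\<close> of the vertex list,
  where the matrix that defines the spectrum has entries \<open>adj E i j\<close>.\<close>

lemma second_eigenvalue_multiplicity_bound:
  fixes G :: "('a, 'b) pre_digraph"
  assumes G: "graph G" and verts: "verts G \<noteq> {}" and l0: "0 < second_eigenvalue G"
    and \<Delta>: "real (max_degree G) \<le> \<Delta>" and deg: "2 \<le> max_degree G"
    and M: "16 \<le> M" "M \<le> second_eigenvalue G" "M * log 2 M \<le> log \<Delta> (real (card (verts G)))"
  shows "real (eigenvalue_multiplicity G (second_eigenvalue G)) \<le> 4 * real (card (verts G)) * log 2 M / M"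
proof -
  interpret graph G by (rule G)
  define n where "n = card (verts G)"
  define vs where "vs = vertex_list G"
  have "\<exists>vs. distinct vs \<and> set vs = verts G" using finite_distinct_list[OF finite_verts] by blast
  then have "distinct vs \<and> set vs = verts G"
    unfolding vs_def vertex_list_def by (rule someI_ex)
  then have vs: "distinct vs" "set vs = verts G" by auto
  then have len: "length vs = n" unfolding n_def by (metis distinct_card)
  have out: "out_degree G v \<le> max_degree G" if "v \<in> verts G" for v
    unfolding max_degree_def using that by (intro Max_ge) auto
  define E where "E i j \<longleftrightarrow> vs ! i \<rightarrow>\<^bsub>G\<^esub> vs ! j" for i j
  have E: "E i j \<Longrightarrow> E j i" for i j
    unfolding E_def by (rule arcs_ends_symmetric[OF sym_arcs])
  have degE: "card {u \<in> {..<n}. E v u} \<le> max_degree G" if "v \<in> {..<n}" for v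
  proof -
    have "card {u \<in> {..<n}. E v u} = card ((!) vs ` {u \<in> {..<n}. E v u})"
      using vs len by (intro card_image[symmetric]) (auto simp: inj_on_def nth_eq_iff_index_eq)
    also have "\<dots> \<le> card (head G ` out_arcs G (vs ! v))"
      by (intro card_mono) (auto simp: E_def arcs_ends_conv)
    also have "\<dots> \<le> out_degree G (vs ! v)" unfolding out_degree_def by (rule card_image_le) auto
    also have "\<dots> \<le> max_degree G" using that vs(2) len by (intro out) (metis lessThan_iff nth_mem)
    finally show ?thesis .
  qed
  define A where "A = adjacency_matrix G"
  have A: "A \<in> carrier_mat n n" by (simp add: A_def adjacency_matrix_def n_def)
  have Aij: "A $$ (i, j) = adj E i j" if "i < n" "j < n" for i j
    using that by (simp add: A_def adjacency_matrix_def n_def adj_def E_def vs_def)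
  have symE: "adj E i j = adj E j i" for i j using E by (auto simp: adj_def)
  have symA: "A $$ (i, j) = A $$ (j, i)" if "i < n" "j < n" for i j
    using Aij[OF that] Aij[OF that(2,1)] symE[of i j] by simp
  obtain es x where es: "length es = n" "proots (char_poly A) = mset es"
    and on: "orthonormal_on {..<n} {..<n} x"
    and ev: "\<And>i v. i < n \<Longrightarrow> v < n \<Longrightarrow> mat_op {..<n} (\<lambda>i j. A $$ (i, j)) (x i) v = es ! i * x i v"
    by (rule real_symmetric_eigenbasis[OF A symA]) blast+
  have ev: "mat_op {..<n} (adj E) (x i) v = es ! i * x i v" if "i < n" "v < n" for i v
    using ev[OF that] that by (simp add: mat_op_def Aij)
  define l where "l = second_eigenvalue G"
  have l: "l = rev (sort es) ! 1"
    unfolding l_def second_eigenvalue_def graph_spectrum_def A_def[symmetric] es(2) by simp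
  \<comment> \<open>Entry 1 of the sorted spectrum has to exist. Without parallel arcs a vertex of
    degree at least 2 has that many distinct heads.\<close>
  have "2 \<le> n"
  proof -
    have "max_degree G \<in> out_degree G ` verts G"
      unfolding max_degree_def using verts by (intro Max_in) auto
    then obtain v where v: "out_degree G v = max_degree G" by auto
    have "inj_on (head G) (out_arcs G v)"
      by (rule inj_onI) (auto intro: no_multi_arcs simp: arc_to_ends_def)
    then have "card (head G ` out_arcs G v) = out_degree G v"
      unfolding out_degree_def by (rule card_image)
    moreover have "card (head G ` out_arcs G v) \<le> n"
      unfolding n_def by (intro card_mono) auto
    ultimately show ?thesis using v deg by simp
  qed
  then have "2 \<le> length es" by (simp add: es(1))
  then obtain i0 where "i0 < length es" "\<And>i. i < length es \<Longrightarrow> i \<noteq> i0 \<Longrightarrow> es ! i \<le> rev (sort es) ! 1"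
    by (rule all_but_one_le_second_largest) blast
  then have i0: "es ! i \<le> l" if "i < n" "i \<noteq> i0" for i using that by (simp add: l es(1))
  \<comment> \<open>Counting a value in the spectrum is counting its positions in \<open>es\<close>,
    hence members of the orthonormal eigenbasis.\<close>
  define J where "J = {i. i < n \<and> es ! i = l}"
  have mult: "eigenvalue_multiplicity G l = card J"
    unfolding eigenvalue_multiplicity_def graph_spectrum_def A_def[symmetric] es(2)
    by (simp add: count_mset count_list_eq_length_filter length_filter_conv_card J_def es(1) eq_commute)
  have J: "finite J" "J \<subseteq> {..<n}" by (auto simp: J_def)
  have rayleigh: "inner_on {..<n} h (mat_op {..<n} (adj E) h) \<le> l * inner_on {..<n} h h"
    if "inner_on {..<n} h (x i0) = 0" for h
    by (rule rayleigh_second_eigenvalue[OF on ev i0 that])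
  have sep: "quad_form_bounded E {..<n} F l \<or> quad_form_bounded E {..<n} G' l"
    if "F \<subseteq> {..<n}" "G' \<subseteq> {..<n}" "F \<inter> G' = {}" "\<forall>u\<in>F. \<forall>v\<in>G'. \<not> E u v" for F G'
    by (rule separated_sets_quad_form_bounded[OF _ E _ rayleigh that]) (use l0 in \<open>simp_all add: l_def\<close>)
  have "real (card J) \<le> 4 * real n * log 2 M / M"
  proof (rule parameter_choice[where lam = l and \<Delta> = \<Delta> and d = "max_degree G"])
    show "16 \<le> M" "M \<le> l" "M * log 2 M \<le> log \<Delta> (real n)" "2 \<le> max_degree G" "real (max_degree G) \<le> \<Delta>"
      using M deg \<Delta> by (auto simp: l_def n_def)
    show "0 < real n" using \<open>2 \<le> n\<close> by simp
    show "real (card J) \<le> real n" using J card_mono[of "{..<n}" J] by simp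
    fix r t :: nat and p :: real
    assume rtp: "1 \<le> r" "1 \<le> t" "0 \<le> p" "p \<le> 1"
    have onJ: "orthonormal_on {..<n} J x" using on J(2) unfolding orthonormal_on_def by blast
    have evJ: "mat_op {..<n} (adj E) (x j) v = l * x j v" if "j \<in> J" "v \<in> {..<n}" for j v
      using that ev by (auto simp: J_def)
    have l1: "1 \<le> l" using M by (simp add: l_def)
    have "real (card J) \<le> real (max_degree G) ^ (2 * r + 2) + p * real (card {..<n})
        + real (card {..<n}) * ((1 - p) ^ t + (real t + 1) ^ (2 * r) * (l\<^sup>2) ^ t / l ^ (2 * r))"
      by (rule multiplicity_bound[OF finite_lessThan E degE deg sep J(1) onJ evJ l1 rtp(1,3,4,2)])
    then show "real (card J) \<le> real (max_degree G) ^ (2 * r + 2) + p * real n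
        + real n * ((1 - p) ^ t + (real t + 1) ^ (2 * r) * (l\<^sup>2) ^ t / l ^ (2 * r))"
      unfolding card_lessThan .
  qed simp
  then show ?thesis using mult by (simp add: l_def n_def)
qed


theorem theorem2p6:
  fixes G :: "('a, 'b) pre_digraph" and n :: nat and lam2 \<Delta> :: real
  assumes "graph G" and "Digraph_Component.connected G"
    and "n = card (verts G)"
    and "lam2 = second_eigenvalue G" and "lam2 > 0"
    and "\<Delta> \<ge> real (max_degree G)" and "max_degree G \<ge> 2"
  shows "(lam2 * log 2 lam2 \<ge> log \<Delta> (real n) \<and> log \<Delta> (real n) > 2 \<longrightarrow>
            real (eigenvalue_multiplicity G lam2)
              \<le> 4 * real n * (log 2 (log \<Delta> (real n)))\<^sup>2 / log \<Delta> (real n)) \<and>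
         (lam2 * log 2 lam2 \<le> log \<Delta> (real n) \<longrightarrow>
            real (eigenvalue_multiplicity G lam2)
              \<le> 4 * real n * log 2 (lam2 + 1) / lam2)"
proof -
  define m L where "m = real (eigenvalue_multiplicity G lam2)" and "L = log \<Delta> (real n)"
  have verts: "verts G \<noteq> {}"
    using assms(2) by (auto simp: connected_def strongly_connected_def)
  have trivial: "m \<le> real n"
    unfolding m_def assms(3) of_nat_le_iff by (rule eigenvalue_multiplicity_le_card)
  have bound: "m \<le> 4 * real n * log 2 M / M" if "16 \<le> M" "M \<le> lam2" "M * log 2 M \<le> L" for M
    using second_eigenvalue_multiplicity_bound[OF assms(1) verts _ assms(6,7), of M] that assms(3-5)
    by (simp add: m_def L_def)
  have part1: "m \<le> 4 * real n * (log 2 L)\<^sup>2 / L" if lam2: "L \<le> lam2 * log 2 lam2" and L: "2 < L"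
  proof -
    define k where "k = log 2 L"
    have Lk: "L = 2 powr k" using L by (simp add: k_def)
    have k: "1 < k" using L by (simp add: k_def less_log_iff)
    \<comment> \<open>As \<open>M \<le> L\<close>, its logarithm is at most \<open>k\<close>, so
      that \<open>M * log 2 M\<close> is at most \<open>M * k = L\<close>.\<close>
    define M where "M = L / k"
    have M0: "0 < M" using L k by (simp add: M_def)
    show ?thesis
    proof (cases "16 \<le> M")
      case True
      have "M \<le> lam2"
      proof (rule ccontr)
        assume "\<not> ?thesis"
        then have less: "lam2 < M" by simp
        also have "M \<le> L" using L k by (simp add: M_def field_simps)
        finally have "log 2 lam2 < k" using assms(5) L unfolding k_def by (subst log_less_cancel_iff) auto
        then have "lam2 * log 2 lam2 \<le> lam2 * k" using assms(5) by (intro mult_left_mono) auto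
        also have "\<dots> < M * k" using less k by simp
        also have "\<dots> = L" using k by (simp add: M_def)
        finally show False using lam2 by simp
      qed
      have "M \<le> L" using L k by (simp add: M_def field_simps)
      then have logM: "log 2 M \<le> k" unfolding k_def using M0 L by (subst log_le_cancel_iff) auto
      then have "M * log 2 M \<le> M * k" using M0 by (intro mult_left_mono) auto
      also have "\<dots> = L" using k by (simp add: M_def)
      finally have "m \<le> 4 * real n * log 2 M / M" using True \<open>M \<le> lam2\<close> by (intro bound)
      also have "\<dots> \<le> 4 * real n * k / M" using logM M0 by (intro divide_right_mono mult_left_mono) auto
      also have "\<dots> = 4 * real n * k\<^sup>2 / L" using k L by (simp add: M_def power2_eq_square field_simps)
      finally show ?thesis by (simp add: k_def)
    next
      case False
      then have Lless: "L < 16 * k" using k by (simp add: M_def field_simps)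
      \<comment> \<open>This reduces the case \<open>M < 16\<close> to the trivial bound. For
        \<open>4 \<le> k\<close> it follows from \<open>L < 16 * k\<close>; below,
        \<open>L = 2 powr k\<close> is at most 16 or 4, and \<open>2 < L\<close> settles the last
        range through \<open>1 < k\<close>.\<close>
      have "L \<le> 4 * k\<^sup>2"
      proof -
        consider "4 \<le> k" | "2 \<le> k" "k < 4" | "k < 2" by linarith
        then show ?thesis
        proof cases
          case 1
          then have "4 * (4 * k) \<le> 4 * (k * k)" by (intro mult_left_mono mult_right_mono) auto
          then show ?thesis using Lless by (simp add: power2_eq_square)
        next
          case 2
          then have "L \<le> 2 powr 4" unfolding Lk by (intro powr_mono) auto
          moreover have "2\<^sup>2 \<le> k\<^sup>2" using 2 by (intro power_mono) auto
          ultimately show ?thesis by simp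
        next
          case 3
          then have "L \<le> 2 powr 2" unfolding Lk by (intro powr_mono) auto
          moreover have "1\<^sup>2 \<le> k\<^sup>2" using k by (intro power_mono) auto
          ultimately show ?thesis by simp
        qed
      qed
      then have "real n * L \<le> real n * (4 * k\<^sup>2)" by (intro mult_left_mono) auto
      then have "real n \<le> 4 * real n * k\<^sup>2 / L" using L by (simp add: field_simps)
      then show ?thesis using trivial by (simp add: k_def)
    qed
  qed
  have part2: "m \<le> 4 * real n * log 2 (lam2 + 1) / lam2" if lam2: "lam2 * log 2 lam2 \<le> L"
  proof (cases "16 \<le> lam2")
    case True
    then have "m \<le> 4 * real n * log 2 lam2 / lam2" using lam2 by (intro bound) auto
    also have "\<dots> \<le> 4 * real n * log 2 (lam2 + 1) / lam2"
      using assms(5) by (intro divide_right_mono mult_left_mono) auto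
    finally show ?thesis .
  next
    case False
    then have "real n * lam2 \<le> real n * (4 * log 2 (lam2 + 1))"
      using log_add_one_ge[of lam2] assms(5) by (intro mult_left_mono) auto
    then have "real n \<le> 4 * real n * log 2 (lam2 + 1) / lam2"
      using assms(5) by (simp add: field_simps)
    then show ?thesis using trivial by linarith
  qed
  show ?thesis using part1 part2 unfolding m_def L_def by blast
qed

end
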